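(* Let $V$ be a discrete valuation ring with maximal ideal $\pi V$ and finite residue field $V/\pi V\cong\mathbb{F}_q$. Let $n\ge 1$ and let $1\le k\le q$. Then, as ideals of $(V/\pi^kV)[x]$, $$N_{V/\pi^kV}(M_n(V/\pi^kV))=(\Phi_{q,n}(x),\pi)^k=(\Phi_{q,n}(x)^k,\ \pi\,\Phi_{q,n}(x)^{k-1},\ \ldots,\ \pi^{k-1}\Phi_{q,n}(x)).$$
   Context: For a commutative ring $R$ and a subset $S$ of some ring containing $R$, the null ideal of $S$ in $R$ is $N_R(S)=\{f\in R[x]\mid f(S)=0\}$, i.e. the set of $f\in R[x]$ with $f(s)=0$ for all $s\in S$; here $V/\pi^kV$ is regarded as the scalar matrices in $M_n(V/\pi^kV)$. For $n\ge1$ and a prime power $q$, $$\Phi_{q,n}(x)=(x^{q^n}-x)(x^{q^{n-1}}-x)\cdots(x^q-x),$$ regarded as a polynomial with coefficients in $V/\pi^kV$. The symbol $\pi$ also denotes its image in $V/\pi^kV$. *)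

theory Defs
  imports
    "HOL-Computational_Algebra.Polynomial"
    "HOL-Library.Numeral_Type"
    "Jordan_Normal_Form.Matrix"
begin

context comm_ring_1
begin

definition is_ideal :: "'a set \<Rightarrow> bool" where
  "is_ideal I \<longleftrightarrow> 0 \<in> I \<and> (\<forall>x\<in>I. \<forall>y\<in>I. x + y \<in> I) \<and> (\<forall>c. \<forall>x\<in>I. c * x \<in> I)"

definition ideal_gen :: "'a set \<Rightarrow> 'a set" where
  "ideal_gen S = \<Inter>{I. is_ideal I \<and> S \<subseteq> I}"

definition is_maximal_ideal :: "'a set \<Rightarrow> bool" where
  "is_maximal_ideal M \<longleftrightarrow>
     is_ideal M \<and> M \<noteq> UNIV \<and> (\<forall>J. is_ideal J \<longrightarrow> M \<subseteq> J \<longrightarrow> J = M \<or> J = UNIV)"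

definition ideal_mult :: "'a set \<Rightarrow> 'a set \<Rightarrow> 'a set" where
  "ideal_mult I J = ideal_gen {a * b | a b. a \<in> I \<and> b \<in> J}"

primrec ideal_power :: "'a set \<Rightarrow> nat \<Rightarrow> 'a set" where
  "ideal_power I 0 = UNIV"
| "ideal_power I (Suc k) = ideal_mult I (ideal_power I k)"

lemma ideal_gen_singleton: "ideal_gen {a} = {x. a dvd x}"
proof (rule subset_antisym)
  have "is_ideal {x. a dvd x}"
    by (simp add: is_ideal_def)
  then show "ideal_gen {a} \<subseteq> {x. a dvd x}"
    by (auto simp: ideal_gen_def)
  show "{x. a dvd x} \<subseteq> ideal_gen {a}"
    by (auto simp: ideal_gen_def is_ideal_def dvd_def mult.commute)
qed

end

lemma module_times: "Modules.module ((*) :: 'a::comm_ring_1 \<Rightarrow> 'a \<Rightarrow> 'a)"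
  by unfold_locales (simp_all add: algebra_simps)

lemma is_ideal_eq_subspace: "is_ideal = Modules.module.subspace (*)"
  by (rule ext) (simp add: is_ideal_def Modules.module.subspace_def[OF module_times])

lemma ideal_gen_eq_span: "ideal_gen = Modules.module.span (*)"
  by (rule ext) (simp add: ideal_gen_def is_ideal_eq_subspace
      Modules.module.span_def[OF module_times] hull_def)

text \<open>
  A discrete valuation ring is a principal ideal domain with exactly one maximal ideal, this ideal
  being nonzero (so that the ring is not a field).  The chosen generator of the maximal ideal is a
  class parameter: an instance is a discrete valuation ring together with an arbitrary uniformizer.
\<close>

class dvr = idom +
  fixes uniformizer :: 'a
  assumes ideal_principal: "is_ideal I \<Longrightarrow> \<exists>a. I = ideal_gen {a}"
    and maximal_ideal_iff: "is_maximal_ideal M \<longleftrightarrow> M = ideal_gen {uniformizer}"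
    and uniformizer_nonzero: "uniformizer \<noteq> 0"

lemma uniformizer_not_unit: "\<not> (uniformizer :: 'a::dvr) dvd 1"
proof
  assume "(uniformizer :: 'a) dvd 1"
  then have "ideal_gen {uniformizer :: 'a} = UNIV"
    by (auto simp: ideal_gen_singleton intro: dvd_trans)
  moreover have "is_maximal_ideal (ideal_gen {uniformizer :: 'a})"
    by (simp add: maximal_ideal_iff)
  ultimately show False
    by (simp add: is_maximal_ideal_def)
qed

text \<open>
  The quotient ring of $V$ by the ideal generated by the $k$-th power of the uniformizer.  The
  exponent $k \ge 1$ is encoded as the cardinality of the finite type \<open>'k\<close>; thus
  \<open>('v, 1) dvr_quot\<close> is the residue field of \<open>'v\<close>.
\<close>

quotient_type (overloaded) ('v, 'k) dvr_quot = "'v::dvr" /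
  "\<lambda>x y. x - y \<in> ideal_gen {uniformizer ^ CARD('k::finite)}"
proof (rule equivpI)
  show "reflp (\<lambda>x y :: 'v. x - y \<in> ideal_gen {uniformizer ^ CARD('k)})"
    by (rule reflpI) (simp add: ideal_gen_singleton)
  show "symp (\<lambda>x y :: 'v. x - y \<in> ideal_gen {uniformizer ^ CARD('k)})"
  proof (rule sympI, unfold ideal_gen_singleton mem_Collect_eq)
    fix x y :: 'v
    assume "uniformizer ^ CARD('k) dvd x - y"
    then have "uniformizer ^ CARD('k) dvd - (x - y)"
      by (simp only: dvd_minus_iff)
    then show "uniformizer ^ CARD('k) dvd y - x"
      by (simp only: minus_diff_eq)
  qed
  show "transp (\<lambda>x y :: 'v. x - y \<in> ideal_gen {uniformizer ^ CARD('k)})"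
  proof (rule transpI, unfold ideal_gen_singleton mem_Collect_eq)
    fix x y z :: 'v
    assume "uniformizer ^ CARD('k) dvd x - y" "uniformizer ^ CARD('k) dvd y - z"
    then have "uniformizer ^ CARD('k) dvd (x - y) + (y - z)"
      by (rule dvd_add)
    then show "uniformizer ^ CARD('k) dvd x - z"
      by simp
  qed
qed

instantiation dvr_quot :: (dvr, finite) comm_ring_1
begin

lift_definition zero_dvr_quot :: "('a, 'b) dvr_quot" is 0 .

lift_definition one_dvr_quot :: "('a, 'b) dvr_quot" is 1 .

lift_definition plus_dvr_quot ::
    "('a, 'b) dvr_quot \<Rightarrow> ('a, 'b) dvr_quot \<Rightarrow> ('a, 'b) dvr_quot" is "(+)"
  unfolding ideal_gen_singleton mem_Collect_eq add_diff_add by (rule dvd_add)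

lift_definition uminus_dvr_quot :: "('a, 'b) dvr_quot \<Rightarrow> ('a, 'b) dvr_quot" is uminus
  unfolding ideal_gen_singleton mem_Collect_eq minus_diff_minus dvd_minus_iff .

lift_definition minus_dvr_quot ::
    "('a, 'b) dvr_quot \<Rightarrow> ('a, 'b) dvr_quot \<Rightarrow> ('a, 'b) dvr_quot" is "(-)"
proof (unfold ideal_gen_singleton mem_Collect_eq)
  fix x y z w :: 'a
  assume "uniformizer ^ CARD('b) dvd x - y" "uniformizer ^ CARD('b) dvd z - w"
  then have "uniformizer ^ CARD('b) dvd (x - y) - (z - w)"
    by (rule dvd_diff)
  then show "uniformizer ^ CARD('b) dvd x - z - (y - w)"
    by (simp add: algebra_simps)
qed

lift_definition times_dvr_quot ::
    "('a, 'b) dvr_quot \<Rightarrow> ('a, 'b) dvr_quot \<Rightarrow> ('a, 'b) dvr_quot" is "(*)"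
  unfolding ideal_gen_singleton mem_Collect_eq mult_diff_mult
  by (simp add: dvd_add)

instance
proof
  show "(0 :: ('a, 'b) dvr_quot) \<noteq> 1"
  proof (transfer, unfold ideal_gen_singleton mem_Collect_eq)
    have "(uniformizer :: 'a) dvd 1" if "(uniformizer :: 'a) ^ CARD('b) dvd 1"
      using dvd_trans[OF dvd_power that] by simp
    then show "\<not> (uniformizer :: 'a) ^ CARD('b) dvd 0 - 1"
      using uniformizer_not_unit by auto
  qed
qed (transfer; simp add: ideal_gen_singleton algebra_simps)+

end

lift_definition quot_map :: "'v::dvr \<Rightarrow> ('v, 'k::finite) dvr_quot" is "\<lambda>x. x" .

text \<open>
  Evaluation of a polynomial at an $n \times n$ matrix, the coefficients acting as scalar matrices.
\<close>

definition mat_eval :: "nat \<Rightarrow> 'r::comm_ring_1 poly \<Rightarrow> 'r mat \<Rightarrow> 'r mat" where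
  "mat_eval n f A = mat n n (\<lambda>(i, j). \<Sum>m\<le>degree f. coeff f m * (A ^\<^sub>m m) $$ (i, j))"

definition null_ideal :: "nat \<Rightarrow> 'r::comm_ring_1 mat set \<Rightarrow> 'r poly set" where
  "null_ideal n S = {f. \<forall>A\<in>S. mat_eval n f A = 0\<^sub>m n n}"

definition Phi :: "nat \<Rightarrow> nat \<Rightarrow> 'r::comm_ring_1 poly" where
  "Phi q n = (\<Prod>i = 1..n. monom 1 (q ^ i) - monom 1 1)"

end

theory Submission
  imports Defs "Jordan_Normal_Form.Char_Poly"
begin

text \<open>
  Write $K = V/\pi V$, a field with $q$ elements, and $\Phi = \Phi_{q,n}$.  Everything is proved for
  polynomials over $V$ itself, where the claim reads: $f(A)$ is divisible by $\pi^k$ for every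
  $n \times n$ matrix $A$ over $V$ if and only if $f$ lies in $(\Phi, \pi)^k$.  Only the last
  section passes to the quotient $V/\pi^k V$.

  Over $K$, an irreducible $p$ of degree $d$ divides $x^{q^i} - x$ exactly when $d$ divides $i$, and
  never twice.  So $p$ occurs in $\Phi$ with multiplicity $\lfloor n/d \rfloor$
  (\<open>multiplicity_Phi\<close>), the largest $e$ with $\deg p^e \le n$, and $\Phi$ is the least common
  multiple of the nonzero polynomials of degree at most $n$.

  Every column of a matrix over $K$ is annihilated by some nonzero polynomial of degree at most $n$,
  since $n + 1$ vectors in $K^n$ are linearly dependent; hence $\Phi$ annihilates all matrices over
  $K$ (\<open>mat_eval_Phi_eq_0\<close>).  For $A$ over $V$ this says $\pi \mid \Phi(A)$, and therefore
  $\pi^k$ divides $\pi^i \Phi(A)^{k-i}$.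

  Conversely, suppose that $\pi^k$ divides $f(A)$ for all $A$.  A companion matrix shows that every
  monic $F$ of degree $n$ divides $f$ modulo $\pi^k$ (\<open>monic_dvd_mod_if_mat_eval_dvd\<close>), and
  membership in $(\Phi, \pi)^k$ follows by induction on $k$ (\<open>ex_sum_powers_of_Phi\<close>).  In the
  step from $k$ to $k + 1 \le q$ one has $f = \sum_{i \le k} \pi^{k-i} h_i \Phi^i$ and must
  show that $\Phi$ divides each $h_i$ modulo $\pi$, that is, that $p^e$ does for each irreducible
  $p$ over $K$ with $e = \lfloor n/d \rfloor$.  Write $\Phi = P^e U + \pi W$ with $P$ a monic lift of
  $p$, so that $p$ does not divide $u$, the reduction of $U$.  Modulo $D = P^e - \pi c$, a divisor of a
  monic polynomial of degree $n$, one has $\Phi = \pi (c U + W)$ and hence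
  $f = \pi^k \sum_i h_i (c U + W)^i$.  As $D$ divides $f$ modulo $\pi^{k+1}$, cancelling
  $\pi^k$ and reducing gives $p^e \mid \sum_i \bar h_i (\bar c u + w)^i$ for every $\bar c \in K$.  So
  a polynomial of degree at most $k < q$ over $K[x]/p^e$ vanishes at $q$ points whose differences are
  units, and all its coefficients $\bar h_i$ vanish (\<open>dvd_coeff_if_dvd_poly_at_many\<close>).  This
  is where $k \le q$ enters.
\<close>

section \<open>Polynomials with many zeros modulo an element\<close>

text \<open>
  Modulo $m$, a polynomial with more zeros than its degree vanishes, provided that the differences of
  the zeros cancel modulo $m$: each zero splits off a linear factor.  It serves both for a prime $m$,
  where incongruent elements have this property, and for a prime power $m$ in the main induction.
\<close>

lemma dvd_coeff_if_dvd_poly_at_many: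
  fixes m :: "'a::comm_ring_1"
  assumes "finite T" "degree P < card T"
    and "\<And>t. t \<in> T \<Longrightarrow> m dvd poly P t"
    and "\<And>s t a. s \<in> T \<Longrightarrow> t \<in> T \<Longrightarrow> s \<noteq> t \<Longrightarrow> m dvd (s - t) * a \<Longrightarrow> m dvd a"
  shows "m dvd coeff P i"
proof -
  have main: "\<forall>i. m dvd coeff P i"
    if "degree P \<le> n" "n < card T" "finite T" "\<forall>t\<in>T. m dvd poly P t"
      "\<forall>s\<in>T. \<forall>t\<in>T. s \<noteq> t \<longrightarrow> (\<forall>a. m dvd (s - t) * a \<longrightarrow> m dvd a)" for n P and T :: "'a set"
    using that
  proof (induction n arbitrary: P T)
    case 0
    then obtain c where P: "P = [:c:]"
      by (metis degree_eq_zeroE le_zero_eq)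
    from 0 obtain t where "t \<in> T"
      by (metis card.empty ex_in_conv less_irrefl)
    with 0 P have "m dvd c"
      by auto
    then show ?case
      using P by (auto simp: coeff_pCons split: nat.split)
  next
    case (Suc n)
    then obtain t where t: "t \<in> T"
      by (metis card.empty ex_in_conv not_less_zero)
    define Q where "Q = synthetic_div P t"
    have P: "P = [:- t, 1:] * Q + [:poly P t:]"
      using synthetic_div_correct'[of t P] by (simp add: Q_def)
    have mt: "m dvd poly P t"
      using Suc t by blast
    have "m dvd poly Q s" if s: "s \<in> T - {t}" for s
    proof -
      have "poly P s = (s - t) * poly Q s + poly P t"
        by (subst P) (simp add: algebra_simps)
      moreover have "m dvd poly P s"
        using Suc s by blast
      ultimately have "m dvd (s - t) * poly Q s"
        using mt by (metis add_diff_cancel_right' dvd_diff)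
      then show ?thesis
        using Suc.prems(5) s t by blast
    qed
    moreover have "degree Q \<le> n"
      using Suc.prems(1) by (simp add: Q_def degree_synthetic_div)
    moreover have "n < card (T - {t})"
      using Suc.prems t by simp
    ultimately have IH: "\<forall>i. m dvd coeff Q i"
      using Suc.prems(3,5) by (intro Suc.IH[of Q "T - {t}"]) blast+
    show ?case
    proof
      fix i
      have "coeff P i = coeff (pCons 0 Q) i - t * coeff Q i + coeff [:poly P t:] i"
        by (subst P) simp
      also have "m dvd \<dots>"
      proof (intro dvd_add dvd_diff)
        show "m dvd coeff (pCons 0 Q) i"
          using IH by (cases i) auto
        show "m dvd t * coeff Q i"
          using IH by (intro dvd_mult) blast
        show "m dvd coeff [:poly P t:] i"
          using mt by (cases i) auto
      qed
      finally show "m dvd coeff P i" .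
    qed
  qed
  show ?thesis
    using main[OF order_refl assms(2,1)] assms(3,4) by blast
qed

section \<open>The factorization of $\Phi$ over a finite field\<close>

text \<open>
  Fermat's argument: multiplication by $a$ permutes the nonzero residues modulo $m$, so it does not
  change their product, which may be cancelled.  The quotient by $m$ is represented by the finite
  set $S$; the choice $m = 0$ gives finite fields, and irreducible polynomials give their residue
  class fields.
\<close>

lemma fermat_mod_finite_residues:
  fixes m :: "'a::idom"
  assumes S: "finite S" and reps: "\<And>a. \<exists>!s. s \<in> S \<and> m dvd a - s"
    and prime: "\<And>a b. m dvd a * b \<Longrightarrow> m dvd a \<or> m dvd b" and proper: "\<not> m dvd 1"
  shows "m dvd a ^ card S - a"
proof (cases "m dvd a")
  case True
  have "card S > 0"
    using S reps by (auto simp: card_gt_0_iff)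
  then have "m dvd a ^ card S"
    using dvd_trans[OF True dvd_power[of "card S" a]] by simp
  then show ?thesis
    using True by simp
next
  case False
  define rep where "rep b = (THE s. s \<in> S \<and> m dvd b - s)" for b
  have rep: "rep b \<in> S" "m dvd b - rep b" for b
    using theI'[OF reps[of b]] by (auto simp: rep_def)
  have uniq: "s = t" if "s \<in> S" "t \<in> S" "m dvd s - t" for s t
  proof -
    obtain u where "\<And>v. v \<in> S \<and> m dvd s - v \<Longrightarrow> v = u"
      using reps[of s] by blast
    from this[of s] this[of t] show ?thesis
      using that by simp
  qed
  have rep_iff: "m dvd rep b \<longleftrightarrow> m dvd b" for b
    using dvd_add_right_iff[OF rep(2)[of b], of "rep b"] by simp
  define U where "U = {s \<in> S. \<not> m dvd s}"
  have finU: "finite U"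
    using S by (simp add: U_def)
  have "S = insert (rep 0) U" "rep 0 \<notin> U"
  proof -
    show "rep 0 \<notin> U"
      by (simp add: U_def rep_iff)
    have "s = rep 0" if "s \<in> S" "m dvd s" for s
      using that rep[of 0] by (intro uniq) auto
    then show "S = insert (rep 0) U"
      using rep(1)[of 0] by (auto simp: U_def)
  qed
  then have card: "card S = Suc (card U)"
    using finU by simp
  have inj: "inj_on (\<lambda>s. rep (a * s)) U"
  proof (rule inj_onI)
    fix s t assume st: "s \<in> U" "t \<in> U" and eq: "rep (a * s) = rep (a * t)"
    have "m dvd (a * s - rep (a * s)) - (a * t - rep (a * t))"
      by (intro dvd_diff rep)
    then have "m dvd a * (s - t)"
      by (simp add: eq algebra_simps)
    then have "m dvd s - t"
      using prime[of a "s - t"] False by blast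
    then show "s = t"
      using st uniq[of s t] by (auto simp: U_def)
  qed
  have "(\<lambda>s. rep (a * s)) ` U \<subseteq> U"
  proof safe
    fix s assume "s \<in> U"
    then have "\<not> m dvd a * s"
      using prime[of a s] False by (auto simp: U_def)
    then show "rep (a * s) \<in> U"
      using rep(1) by (simp add: U_def rep_iff)
  qed
  then have img: "(\<lambda>s. rep (a * s)) ` U = U"
    using inj finU by (simp add: endo_inj_surj)
  have cong: "m dvd (\<Prod>s\<in>A. a * s) - (\<Prod>s\<in>A. rep (a * s))" if "finite A" for A
    using that
  proof induction
    case (insert s A)
    have "m dvd (a * s - rep (a * s)) * (\<Prod>s\<in>A. a * s)
        + rep (a * s) * ((\<Prod>s\<in>A. a * s) - (\<Prod>s\<in>A. rep (a * s)))"
      using dvd_mult2[OF rep(2)] dvd_mult[OF insert.IH] by (rule dvd_add)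
    then show ?case
      using insert.hyps by (simp add: algebra_simps)
  qed simp
  have "(\<Prod>s\<in>U. rep (a * s)) = \<Prod>U"
    using prod.reindex[OF inj, of "\<lambda>x. x"] img by (simp add: o_def)
  then have "m dvd a ^ card U * \<Prod>U - \<Prod>U"
    using cong[OF finU] by (simp add: prod.distrib)
  then have "m dvd (a ^ card U - 1) * \<Prod>U"
    by (simp add: left_diff_distrib)
  then have "m dvd a ^ card U - 1 \<or> m dvd \<Prod>U"
    by (rule prime)
  moreover have "\<not> m dvd \<Prod>A" if "finite A" "A \<subseteq> U" for A
    using that
  proof induction
    case empty
    then show ?case using proper by simp
  next
    case (insert s A)
    then have "\<not> m dvd s" "\<not> m dvd \<Prod>A"
      by (auto simp: U_def)
    then show ?case
      using prime[of s "\<Prod>A"] insert.hyps by auto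
  qed
  ultimately have "m dvd a ^ card U - 1"
    using finU by blast
  then have "m dvd a * (a ^ card U - 1)"
    by simp
  then show ?thesis
    by (simp add: card algebra_simps)
qed

lemma finite_field_power_card:
  fixes a :: "'f::field"
  assumes "finite (UNIV :: 'f set)"
  shows "a ^ CARD('f) = a"
  using fermat_mod_finite_residues[OF assms, of 0 a] by auto

lemma finite_field_one_less_card:
  assumes "finite (UNIV :: 'f::field set)"
  shows "1 < CARD('f)"
proof -
  have "card {0, 1 :: 'f} \<le> CARD('f)"
    using assms by (intro card_mono) auto
  then show ?thesis
    by simp
qed

text \<open>
  The polynomial $(x + 1)^q - x^q - 1$ has degree less than $q$ and vanishes on all $q$ elements of
  the field, so it is zero, and its coefficients are these binomial coefficients.  Their vanishing
  makes the $q$-th power map additive.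
\<close>

lemma of_nat_choose_card_eq_0:
  assumes fin: "finite (UNIV :: 'f::field set)" and i: "0 < i" "i < CARD('f)"
  shows "of_nat (CARD('f) choose i) = (0 :: 'f)"
proof -
  define q where "q = CARD('f)"
  have q: "1 < q"
    using finite_field_one_less_card[OF fin] by (simp add: q_def)
  define P :: "'f poly" where "P = (\<Sum>i\<in>{0<..<q}. monom (of_nat (q choose i)) i)"
  have "poly P a = 0" for a
  proof -
    have "(a + 1) ^ q = (\<Sum>i\<le>q. of_nat (q choose i) * a ^ i)"
      using binomial_ring[of a 1 q] by simp
    also have "{..q} = insert 0 (insert q {0<..<q})"
      using q by auto
    also have "(\<Sum>i\<in>\<dots>. of_nat (q choose i) * a ^ i) = 1 + (a ^ q + poly P a)"
      using q by (simp add: P_def poly_sum poly_monom)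
    finally show ?thesis
      using finite_field_power_card[OF fin, of a] finite_field_power_card[OF fin, of "a + 1"]
      by (simp add: q_def)
  qed
  moreover have "degree P < q"
    unfolding P_def using q
    by (intro degree_sum_less) (auto intro: le_less_trans[OF degree_monom_le])
  ultimately have "0 dvd coeff P i"
    using fin by (intro dvd_coeff_if_dvd_poly_at_many[of UNIV]) (auto simp: q_def)
  moreover have "coeff P i = of_nat (q choose i)"
    using i by (simp add: P_def coeff_sum q_def)
  ultimately show ?thesis
    by (simp add: q_def)
qed

lemma of_nat_card_eq_0:
  assumes "finite (UNIV :: 'f::field set)"
  shows "of_nat CARD('f) = (0 :: 'f)"
  using of_nat_choose_card_eq_0[OF assms, of 1] finite_field_one_less_card[OF assms] by simp

lemma poly_add_power_card:
  fixes f g :: "'f::field poly"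
  assumes fin: "finite (UNIV :: 'f set)"
  shows "(f + g) ^ (CARD('f) ^ i) = f ^ (CARD('f) ^ i) + g ^ (CARD('f) ^ i)"
proof (induction i)
  case (Suc i)
  define q where "q = CARD('f)"
  have q: "1 < q"
    using finite_field_one_less_card[OF fin] by (simp add: q_def)
  have *: "(f + g) ^ q = f ^ q + g ^ q" for f g :: "'f poly"
  proof -
    have "(f + g) ^ q = (\<Sum>i\<le>q. of_nat (q choose i) * f ^ i * g ^ (q - i))"
      by (rule binomial_ring)
    also have "{..q} = insert 0 (insert q {0<..<q})"
      using q by auto
    also have "(\<Sum>i\<in>\<dots>. of_nat (q choose i) * f ^ i * g ^ (q - i)) = g ^ q + (f ^ q
        + (\<Sum>i\<in>{0<..<q}. of_nat (q choose i) * f ^ i * g ^ (q - i)))"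
      using q by simp
    also have "(\<Sum>i\<in>{0<..<q}. of_nat (q choose i) * f ^ i * g ^ (q - i)) = 0"
      using of_nat_choose_card_eq_0[OF fin] by (intro sum.neutral) (simp add: q_def of_nat_poly)
    finally show ?thesis
      by simp
  qed
  have "(f + g) ^ (q ^ Suc i) = ((f + g) ^ (q ^ i)) ^ q"
    by (simp only: power_Suc2 power_mult)
  also have "\<dots> = f ^ (q ^ Suc i) + g ^ (q ^ Suc i)"
    by (simp only: Suc.IH[folded q_def] * power_Suc2 power_mult)
  finally show ?case
    by (simp add: q_def)
qed simp

text \<open>
  The bound is put on the coefficients and not on the degree so that $d = 0$ gives the zero
  polynomial only.
\<close>

lemma polys_vanishing_from:
  assumes fin: "finite (UNIV :: 'f::field set)"
  shows "finite {r :: 'f poly. \<forall>i\<ge>d. coeff r i = 0} \<and>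
    card {r :: 'f poly. \<forall>i\<ge>d. coeff r i = 0} = CARD('f) ^ d"
proof (induction d)
  case 0
  have "{r :: 'f poly. \<forall>i\<ge>0. coeff r i = 0} = {0}"
    by (auto simp: poly_eq_iff)
  then show ?case
    by simp
next
  case (Suc d)
  let ?S = "\<lambda>d. {r :: 'f poly. \<forall>i\<ge>d. coeff r i = 0}"
  have "r \<in> (\<lambda>(a, r). pCons a r) ` (UNIV \<times> ?S d)" if "r \<in> ?S (Suc d)" for r
  proof -
    obtain a s where r: "r = pCons a s"
      by (rule pCons_cases)
    have "coeff s i = 0" if "i \<ge> d" for i
      using \<open>r \<in> ?S (Suc d)\<close> that by (auto simp: r dest: spec[of _ "Suc i"])
    then show ?thesis
      by (force simp: r)
  qed
  then have S: "?S (Suc d) = (\<lambda>(a, r). pCons a r) ` (UNIV \<times> ?S d)"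
    by (auto simp: coeff_pCons split: nat.split)
  have "inj_on (\<lambda>(a, r). pCons a r) (UNIV \<times> ?S d)"
    by (auto simp: inj_on_def)
  then show ?case
    using Suc fin by (simp only: S card_image card_cartesian_product finite_cartesian_product
        finite_imageI) simp
qed

lemma residues_mod_poly:
  fixes p :: "'f::field poly"
  assumes fin: "finite (UNIV :: 'f set)" and p: "degree p > 0"
  shows "finite {r :: 'f poly. degree r < degree p}"
    and "card {r :: 'f poly. degree r < degree p} = CARD('f) ^ degree p"
    and "\<exists>!s. s \<in> {r. degree r < degree p} \<and> p dvd a - s"
proof -
  have "{r :: 'f poly. degree r < degree p} = {r. \<forall>i\<ge>degree p. coeff r i = 0}"
    using p by (auto intro: coeff_eq_0 degree_lessI)
  then show "finite {r :: 'f poly. degree r < degree p}"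
    and "card {r :: 'f poly. degree r < degree p} = CARD('f) ^ degree p"
    using polys_vanishing_from[OF fin] by simp_all
  show "\<exists>!s. s \<in> {r. degree r < degree p} \<and> p dvd a - s"
  proof (rule ex1I[of _ "a mod p"])
    show "a mod p \<in> {r. degree r < degree p} \<and> p dvd a - a mod p"
      using p degree_mod_less[of p a] by (force simp: mod_eq_dvd_iff[symmetric])
  next
    fix s assume "s \<in> {r. degree r < degree p} \<and> p dvd a - s"
    then show "s = a mod p"
      by (metis mem_Collect_eq mod_eq_dvd_iff mod_poly_less)
  qed
qed

lemma degree_prime_elem_pos:
  fixes p :: "'f::field_gcd poly"
  assumes "prime_elem p"
  shows "degree p > 0"
  using is_unit_iff_degree[OF prime_elem_not_zeroI[OF assms]] prime_elem_not_unit[OF assms]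
  by simp

lemma prime_elem_dvd_power_card_power_degree:
  fixes p :: "'f::field_gcd poly"
  assumes fin: "finite (UNIV :: 'f set)" and p: "prime_elem p"
  shows "p dvd f ^ (CARD('f) ^ (degree p * j)) - f"
proof (induction j)
  case (Suc j)
  note S = residues_mod_poly[OF fin degree_prime_elem_pos[OF p]]
  define g where "g = f ^ (CARD('f) ^ (degree p * j))"
  have "p dvd g ^ (CARD('f) ^ degree p) - g"
    using fermat_mod_finite_residues[OF S(1,3) _ prime_elem_not_unit[OF p], of g]
    by (simp add: S(2) prime_elem_dvd_mult_iff[OF p])
  then have "p dvd g ^ (CARD('f) ^ degree p) - f"
    using Suc dvd_add[of p "g ^ (CARD('f) ^ degree p) - g" "g - f"] by (simp add: g_def)
  moreover have "g ^ (CARD('f) ^ degree p) = f ^ (CARD('f) ^ (degree p * Suc j))"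
    by (simp add: g_def power_mult[symmetric] power_add[symmetric] add.commute)
  ultimately show ?case
    by simp
qed simp

text \<open>
  The map $f \mapsto f^{q^i}$ is additive and fixes constants, so it fixes every polynomial modulo
  $p$ as soon as it fixes $x$.
\<close>

lemma dvd_frobenius_minus_id:
  fixes p f :: "'f::field_gcd poly"
  assumes fin: "finite (UNIV :: 'f set)"
    and X: "p dvd monom 1 (CARD('f) ^ i) - monom 1 1"
  shows "p dvd f ^ (CARD('f) ^ i) - f"
proof (induction f)
  case 0
  show ?case
    using finite_field_one_less_card[OF fin] by (simp add: zero_power)
next
  case (pCons a f)
  define q where "q = CARD('f)"
  have a: "a ^ (q ^ i) = a"
    by (induction i) (simp_all add: finite_field_power_card[OF fin] q_def power_mult)
  have "(pCons a f) ^ (q ^ i) = ([:a:] + monom 1 1 * f) ^ (q ^ i)"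
    by (simp add: monom_altdef)
  also have "\<dots> = [:a:] + monom 1 (q ^ i) * f ^ (q ^ i)"
    by (simp add: poly_add_power_card[OF fin, folded q_def] power_mult_distrib monom_power
        poly_const_pow a)
  finally have "(pCons a f) ^ (q ^ i) - pCons a f =
      (monom 1 (q ^ i) - monom 1 1) * f ^ (q ^ i) + monom 1 1 * (f ^ (q ^ i) - f)"
    by (simp add: algebra_simps monom_altdef)
  then show ?case
    using X pCons.IH by (auto simp: q_def)
qed

text \<open>
  In the residue class field of $p$, with $q^d$ elements for $d = \deg p$, the $q^d$-th power map is
  the identity, so only $t = i \bmod d$ matters.  If $t > 0$, then all $q^d$ elements would be zeros
  of $y^{q^t} - y$, which has smaller degree.
\<close>

lemma prime_elem_dvd_X_power_card_power_iff:
  fixes p :: "'f::field_gcd poly"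
  assumes fin: "finite (UNIV :: 'f set)" and p: "prime_elem p"
  shows "p dvd monom 1 (CARD('f) ^ i) - monom 1 1 \<longleftrightarrow> degree p dvd i"
proof
  define q where "q = CARD('f)"
  have q: "1 < q"
    using finite_field_one_less_card[OF fin] by (simp add: q_def)
  assume dvd: "p dvd monom 1 (CARD('f) ^ i) - monom 1 1"
  define t where "t = i mod degree p"
  have t: "t < degree p"
    using degree_prime_elem_pos[OF p] by (simp add: t_def)
  have "p dvd monom 1 (q ^ t) ^ (q ^ (degree p * (i div degree p))) - monom 1 (q ^ t)"
    unfolding q_def by (rule prime_elem_dvd_power_card_power_degree[OF fin p])
  then have "p dvd monom 1 (q ^ i) - monom 1 (q ^ t)"
    by (simp add: monom_power t_def power_add[symmetric])
  then have Xt: "p dvd monom 1 (q ^ t) - monom 1 1"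
    using dvd_diff[OF dvd] by (fastforce simp: q_def)
  have "t = 0"
  proof (rule ccontr)
    assume "t \<noteq> 0"
    then have qt: "1 < q ^ t"
      using q by (intro one_less_power) auto
    note S = residues_mod_poly[OF fin degree_prime_elem_pos[OF p], folded q_def]
    define P :: "'f poly poly" where "P = monom 1 (q ^ t) - monom 1 1"
    have "p dvd coeff P 1"
    proof (rule dvd_coeff_if_dvd_poly_at_many[OF S(1)])
      have "degree P \<le> q ^ t"
        unfolding P_def using qt by (intro degree_diff_le) (auto simp: degree_monom_eq)
      also have "\<dots> < q ^ degree p"
        using q t by simp
      finally show "degree P < card {r :: 'f poly. degree r < degree p}"
        by (simp add: S(2))
      show "p dvd poly P s" for s
        using dvd_frobenius_minus_id[OF fin Xt[unfolded q_def], of s]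
        by (simp add: P_def poly_monom q_def)
      show "p dvd a" if "s \<in> {r. degree r < degree p}" "u \<in> {r. degree r < degree p}" "s \<noteq> u" "p dvd (s - u) * a" for s u a
      proof -
        have "\<not> p dvd s - u"
        proof
          assume "p dvd s - u"
          moreover have "p dvd s - s"
            by simp
          ultimately show False
            using S(3)[of s] that(1-3) by blast
        qed
        then show ?thesis
          using that(4) by (simp add: prime_elem_dvd_mult_iff[OF p])
      qed
    qed
    moreover have "coeff P 1 = - 1"
      using q \<open>t \<noteq> 0\<close> by (simp add: P_def)
    ultimately show False
      using prime_elem_not_unit[OF p] by simp
  qed
  then show "degree p dvd i"
    by (simp add: t_def mod_eq_0_iff_dvd)
next
  assume "degree p dvd i"
  then obtain j where "i = degree p * j" ..
  then show "p dvd monom 1 (CARD('f) ^ i) - monom 1 1"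
    using prime_elem_dvd_power_card_power_degree[OF fin p, of "monom 1 1" j]
    by (simp add: monom_power)
qed

text \<open>
  The derivative of $x^{q^i} - x$ is $-1$.
\<close>

lemma prime_elem_square_not_dvd:
  fixes p :: "'f::field_gcd poly"
  assumes fin: "finite (UNIV :: 'f set)" and p: "prime_elem p" and i: "0 < i"
  shows "\<not> p ^ 2 dvd monom 1 (CARD('f) ^ i) - monom 1 1"
proof
  assume "p ^ 2 dvd monom 1 (CARD('f) ^ i) - monom 1 1"
  then obtain g where g: "monom 1 (CARD('f) ^ i) - monom 1 1 = p ^ 2 * g" ..
  have "of_nat (CARD('f) ^ i) = (0 :: 'f)"
    using of_nat_card_eq_0[OF fin] i by simp
  then have "pderiv (monom 1 (CARD('f) ^ i) - monom 1 1 :: 'f poly) = - 1"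
    by (simp add: pderiv_diff pderiv_monom)
  moreover have "p dvd pderiv (p ^ 2 * g)"
    by (simp add: power2_eq_square mult.assoc pderiv_mult)
  ultimately have "p dvd 1"
    using g by simp
  then show False
    using prime_elem_not_unit[OF p] by simp
qed

lemma X_power_card_power_minus_X_neq_0:
  assumes fin: "finite (UNIV :: 'f::field set)" and i: "0 < i"
  shows "monom 1 (CARD('f) ^ i) - monom 1 1 \<noteq> (0 :: 'f poly)"
proof -
  have "coeff (monom 1 (CARD('f) ^ i) - monom 1 1 :: 'f poly) 1 = - 1"
    using finite_field_one_less_card[OF fin] i by simp
  then show ?thesis
    by (metis coeff_0 neg_equal_0_iff_equal zero_neq_one)
qed

lemma Phi_card_neq_0:
  assumes fin: "finite (UNIV :: 'f::field set)"
  shows "Phi CARD('f) n \<noteq> (0 :: 'f poly)"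
  using X_power_card_power_minus_X_neq_0[OF fin] by (auto simp: Phi_def simp del: right_minus_eq)

text \<open>
  Exactly the factors $x^{q^i} - x$ with $\deg p \mid i$ contribute, each of them once.
\<close>

lemma multiplicity_Phi:
  fixes p :: "'f::field_gcd poly"
  assumes fin: "finite (UNIV :: 'f set)" and p: "prime_elem p"
  shows "multiplicity p (Phi CARD('f) n) = n div degree p"
proof -
  define q where "q = CARD('f)"
  define d where "d = degree p"
  have d: "d > 0"
    using degree_prime_elem_pos[OF p] by (simp add: d_def)
  have mult: "multiplicity p (monom 1 (q ^ i) - monom 1 1) = (if d dvd i then 1 else 0)"
    if "i > 0" for i
    using prime_elem_dvd_X_power_card_power_iff[OF fin p, of i]
      prime_elem_square_not_dvd[OF fin p that]
    by (auto intro!: multiplicity_eqI simp: q_def d_def power2_eq_square)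
  have "multiplicity p (Phi q n) = (\<Sum>i=1..n. multiplicity p (monom 1 (q ^ i) - monom 1 1))"
    unfolding Phi_def
  proof (rule prime_elem_multiplicity_prod_distrib[OF p])
    show "0 \<notin> (\<lambda>i. monom 1 (q ^ i) - monom 1 1 :: 'f poly) ` {1..n}"
    proof
      assume "0 \<in> (\<lambda>i. monom 1 (q ^ i) - monom 1 1 :: 'f poly) ` {1..n}"
      then obtain i where "i \<in> {1..n}" "monom 1 (q ^ i) - monom 1 1 = (0 :: 'f poly)"
        by (metis (no_types, lifting) imageE)
      then show False
        using X_power_card_power_minus_X_neq_0[OF fin, of i] by (simp add: q_def)
    qed
  qed simp
  also have "\<dots> = (\<Sum>i=1..n. if d dvd i then 1 else 0)"
    using mult by (intro sum.cong) auto
  also have "\<dots> = card {i \<in> {1..n}. d dvd i}"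
    by (simp add: sum.If_cases Int_def)
  also have "{i \<in> {1..n}. d dvd i} = (\<lambda>j. d * j) ` {1..n div d}"
  proof -
    have le: "d * j \<le> n \<longleftrightarrow> j \<le> n div d" for j
      using d by (simp add: less_eq_div_iff_mult_less_eq mult.commute)
    have "i \<in> (\<lambda>j. d * j) ` {1..n div d}" if i: "i \<in> {1..n}" "d dvd i" for i
    proof -
      obtain j where "i = d * j"
        using i(2) ..
      then show ?thesis
        using i(1) le[of j] by (cases "j = 0") auto
    qed
    moreover have "d * j \<in> {i \<in> {1..n}. d dvd i}" if "j \<in> {1..n div d}" for j
      using that le[of j] d by (simp add: Suc_le_eq)
    ultimately show ?thesis
      by blast
  qed
  also have "card \<dots> = n div d"
    using d by (subst card_image) (auto simp: inj_on_def)
  finally show ?thesis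
    by (simp add: q_def d_def)
qed

text \<open>
  If $p^m$ divides $f$, then $m \deg p \le n$, which bounds $m$ by the multiplicity of $p$
  in $\Phi$.
\<close>

lemma dvd_Phi_if_degree_le:
  fixes f :: "'f::field_gcd poly"
  assumes fin: "finite (UNIV :: 'f set)" and "f \<noteq> 0" "degree f \<le> n"
  shows "f dvd Phi CARD('f) n"
proof (rule multiplicity_le_imp_dvd[OF \<open>f \<noteq> 0\<close>])
  fix p :: "'f poly" assume "prime p"
  then have p: "prime_elem p"
    by simp
  have "degree (p ^ multiplicity p f) \<le> degree f"
    using \<open>f \<noteq> 0\<close> by (intro dvd_imp_degree_le multiplicity_dvd)
  then have "multiplicity p f * degree p \<le> n"
    using assms(3) prime_elem_not_zeroI[OF p] by (simp add: degree_power_eq mult.commute)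
  then show "multiplicity p f \<le> multiplicity p (Phi CARD('f) n)"
    using degree_prime_elem_pos[OF p]
    by (simp add: multiplicity_Phi[OF fin p] less_eq_div_iff_mult_less_eq)
qed

section \<open>Evaluation of polynomials at matrices\<close>

hide_const (open) module.smult

lemma mat_eval_carrier [simp]: "mat_eval n f A \<in> carrier_mat n n"
  by (simp add: mat_eval_def)

lemma dim_mat_eval [simp]:
  "dim_row (mat_eval n f A) = n" "dim_col (mat_eval n f A) = n"
  by (simp_all add: mat_eval_def)

lemma index_mat_eval:
  assumes "i < n" "j < n" "degree f \<le> N"
  shows "mat_eval n f A $$ (i, j) = (\<Sum>m\<le>N. coeff f m * (A ^\<^sub>m m) $$ (i, j))"
proof -
  have "mat_eval n f A $$ (i, j) = (\<Sum>m\<le>degree f. coeff f m * (A ^\<^sub>m m) $$ (i, j))"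
    using assms by (simp add: mat_eval_def)
  also have "\<dots> = (\<Sum>m\<le>N. coeff f m * (A ^\<^sub>m m) $$ (i, j))"
    using assms(3) by (intro sum.mono_neutral_left) (auto simp: coeff_eq_0)
  finally show ?thesis .
qed

lemma mat_eval_0 [simp]: "mat_eval n 0 A = 0\<^sub>m n n"
  by (intro eq_matI) (simp_all add: mat_eval_def)

lemma mat_eval_add: "mat_eval n (f + g) A = mat_eval n f A + mat_eval n g A"
proof (intro eq_matI)
  fix i j assume "i < dim_row (mat_eval n f A + mat_eval n g A)"
    "j < dim_col (mat_eval n f A + mat_eval n g A)"
  then have ij: "i < n" "j < n"
    by (simp_all add: mat_eval_def)
  define N where "N = max (degree f) (degree g)"
  have "degree (f + g) \<le> N" "degree f \<le> N" "degree g \<le> N"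
    by (simp_all add: N_def degree_add_le)
  then have "mat_eval n (f + g) A $$ (i, j) = mat_eval n f A $$ (i, j) + mat_eval n g A $$ (i, j)"
    using ij by (simp add: index_mat_eval[of _ _ _ _ N] distrib_right sum.distrib)
  then show "mat_eval n (f + g) A $$ (i, j) = (mat_eval n f A + mat_eval n g A) $$ (i, j)"
    using ij by (simp add: mat_eval_def)
qed (simp_all add: mat_eval_def)

lemma mat_eval_smult: "mat_eval n (smult a f) A = a \<cdot>\<^sub>m mat_eval n f A"
proof (intro eq_matI)
  fix i j assume "i < dim_row (a \<cdot>\<^sub>m mat_eval n f A)" "j < dim_col (a \<cdot>\<^sub>m mat_eval n f A)"
  then have ij: "i < n" "j < n"
    by (simp_all add: mat_eval_def)
  have "mat_eval n (smult a f) A $$ (i, j) = a * mat_eval n f A $$ (i, j)"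
    using ij index_mat_eval[OF ij degree_smult_le[of a f]]
    by (simp add: index_mat_eval[of _ _ _ f "degree f"] sum_distrib_left mult.assoc)
  then show "mat_eval n (smult a f) A $$ (i, j) = (a \<cdot>\<^sub>m mat_eval n f A) $$ (i, j)"
    using ij by (simp add: mat_eval_def)
qed (simp_all add: mat_eval_def)

lemma index_mult_mat_sum:
  assumes "A \<in> carrier_mat n n" "B \<in> carrier_mat n n" "i < n" "j < n"
  shows "(A * B) $$ (i, j) = (\<Sum>l<n. A $$ (i, l) * B $$ (l, j))"
  using assms by (simp add: scalar_prod_def lessThan_atLeast0)

lemma mat_eval_pCons:
  assumes A: "A \<in> carrier_mat n n"
  shows "mat_eval n (pCons a f) A = a \<cdot>\<^sub>m 1\<^sub>m n + mat_eval n f A * A"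
proof (intro eq_matI)
  fix i j assume "i < dim_row (a \<cdot>\<^sub>m 1\<^sub>m n + mat_eval n f A * A)"
    "j < dim_col (a \<cdot>\<^sub>m 1\<^sub>m n + mat_eval n f A * A)"
  then have ij: "i < n" "j < n"
    using A by simp_all
  have "mat_eval n (pCons a f) A $$ (i, j)
      = (\<Sum>m\<le>Suc (degree f). coeff (pCons a f) m * (A ^\<^sub>m m) $$ (i, j))"
    by (intro index_mat_eval ij degree_pCons_le)
  also have "\<dots> = a * (A ^\<^sub>m 0) $$ (i, j)
      + (\<Sum>m\<le>degree f. coeff f m * (A ^\<^sub>m Suc m) $$ (i, j))"
    by (simp only: sum.atMost_Suc_shift coeff_pCons_0 coeff_pCons_Suc)
  also have "\<dots> = a * 1\<^sub>m n $$ (i, j)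
      + (\<Sum>m\<le>degree f. coeff f m * (\<Sum>l<n. (A ^\<^sub>m m) $$ (i, l) * A $$ (l, j)))"
    using A by (simp only: pow_mat.simps carrier_matD
        index_mult_mat_sum[OF pow_carrier_mat[OF A] A ij])
  also have "(\<Sum>m\<le>degree f. coeff f m * (\<Sum>l<n. (A ^\<^sub>m m) $$ (i, l) * A $$ (l, j)))
      = (\<Sum>l<n. (\<Sum>m\<le>degree f. coeff f m * (A ^\<^sub>m m) $$ (i, l)) * A $$ (l, j))"
    unfolding sum_distrib_left sum_distrib_right mult.assoc by (rule sum.swap)
  also have "\<dots> = (mat_eval n f A * A) $$ (i, j)"
    using ij by (simp add: index_mult_mat_sum[OF mat_eval_carrier A]
        index_mat_eval[of _ _ _ f "degree f"])
  finally show "mat_eval n (pCons a f) A $$ (i, j)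
      = (a \<cdot>\<^sub>m 1\<^sub>m n + mat_eval n f A * A) $$ (i, j)"
    using A ij by simp
qed (use A in \<open>simp_all add: mat_eval_def\<close>)

lemma mat_eval_mult:
  fixes A :: "'a::comm_ring_1 mat"
  assumes A: "A \<in> carrier_mat n n"
  shows "mat_eval n (f * g) A = mat_eval n f A * mat_eval n g A"
proof (induction g)
  case 0
  show ?case
    by (simp add: right_mult_zero_mat[OF mat_eval_carrier])
next
  case (pCons a g)
  let ?f = "mat_eval n f A" and ?g = "mat_eval n g A"
  have "mat_eval n (f * pCons a g) A = a \<cdot>\<^sub>m ?f + (0 \<cdot>\<^sub>m 1\<^sub>m n + ?f * ?g * A)"
    by (simp add: mult_pCons_right mat_eval_add mat_eval_smult mat_eval_pCons[OF A] pCons.IH)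
  also have "0 \<cdot>\<^sub>m 1\<^sub>m n + ?f * ?g * A = ?f * (?g * A)"
  proof -
    have "0 \<cdot>\<^sub>m 1\<^sub>m n = (0\<^sub>m n n :: 'a mat)"
      by (intro eq_matI) simp_all
    then show ?thesis
      using A by (simp add: assoc_mult_mat[of _ n n _ n _ n] left_add_zero_mat[of _ n n]
          mult_carrier_mat[of _ n n _ n])
  qed
  also have "a \<cdot>\<^sub>m ?f + ?f * (?g * A) = ?f * (a \<cdot>\<^sub>m 1\<^sub>m n) + ?f * (?g * A)"
    by (subst mult_smult_distrib[of _ n n _ n]) auto
  also have "\<dots> = ?f * (a \<cdot>\<^sub>m 1\<^sub>m n + ?g * A)"
    using A by (subst mult_add_distrib_mat[of _ n n _ n]) auto
  finally show ?case
    by (simp add: mat_eval_pCons[OF A])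
qed

lemma mat_eval_map_poly:
  assumes h: "comm_ring_hom h" and A: "A \<in> carrier_mat n n"
  shows "mat_eval n (map_poly h f) (map_mat h A) = map_mat h (mat_eval n f A)"
proof -
  interpret comm_ring_hom h by (rule h)
  show ?thesis
  proof (intro eq_matI)
    fix i j assume "i < dim_row (map_mat h (mat_eval n f A))"
      "j < dim_col (map_mat h (mat_eval n f A))"
    then have ij: "i < n" "j < n"
      by (simp_all add: mat_eval_def)
    have pow: "(map_mat h A ^\<^sub>m m) $$ (i, j) = h ((A ^\<^sub>m m) $$ (i, j))" for m
      using ij A by (simp add: mat_hom_pow[OF A, symmetric])
    have "mat_eval n (map_poly h f) (map_mat h A) $$ (i, j) = h (mat_eval n f A $$ (i, j))"
      using ij by (simp add: index_mat_eval[of _ _ _ _ "degree f"] degree_map_poly_le pow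
          coeff_map_poly hom_distribs)
    then show "mat_eval n (map_poly h f) (map_mat h A) $$ (i, j)
        = map_mat h (mat_eval n f A) $$ (i, j)"
      using ij by (simp add: mat_eval_def)
  qed (simp_all add: mat_eval_def)
qed

text \<open>
  The first row of $f(D)$, for $D$ the transposed companion matrix of $F$, lists the coefficients of
  the remainder of $f$ modulo $F$.  Indeed the row vector of a remainder times $D$ is the row
  vector of its product with $x$, reduced once by $F$; with rows, the recursion
  $D^{m+1} = D^m D$ applies directly.
\<close>

lemma ex_monic_divisor_mod_mat_eval_row:
  fixes F :: "'a::comm_ring_1 poly"
  assumes monic: "monic F" and deg: "degree F = n" and n: "n > 0"
  shows "\<exists>D\<in>carrier_mat n n. \<forall>f. F dvd f - (\<Sum>j<n. monom (mat_eval n f D $$ (0, j)) j)"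
proof
  define D where "D = mat n n (\<lambda>(l, j). (if j = Suc l then 1 else 0)
    - (if Suc l = n then coeff F j else 0))"
  show D: "D \<in> carrier_mat n n"
    by (simp add: D_def)
  define row where "row f = (\<Sum>j<n. monom (mat_eval n f D $$ (0, j)) j)" for f
  have coeff_row: "coeff (row f) j = (if j < n then mat_eval n f D $$ (0, j) else 0)" for f j
    by (simp add: row_def coeff_sum)
  have step: "mat_eval n (pCons a f) D $$ (0, j) = (if j = 0 then a else coeff (row f) (j - 1))
      - coeff (row f) (n - 1) * coeff F j" if j: "j < n" for a f j
  proof -
    have "mat_eval n (pCons a f) D $$ (0, j)
        = (a \<cdot>\<^sub>m 1\<^sub>m n) $$ (0, j) + (mat_eval n f D * D) $$ (0, j)"
      using j n D unfolding mat_eval_pCons[OF D] by (intro index_add_mat(1)) simp_all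
    also have "(a \<cdot>\<^sub>m 1\<^sub>m n) $$ (0, j) = (if j = 0 then a else 0)"
      using j n by simp
    also have "(mat_eval n f D * D) $$ (0, j) = (\<Sum>l<n. mat_eval n f D $$ (0, l) * D $$ (l, j))"
      by (rule index_mult_mat_sum[OF mat_eval_carrier D n j])
    also have "(\<Sum>l<n. mat_eval n f D $$ (0, l) * D $$ (l, j))
        = (\<Sum>l<n. (if j = Suc l then coeff (row f) l else 0)
            - (if l = n - 1 then coeff (row f) l * coeff F j else 0))"
      using j n by (intro sum.cong) (auto simp: D_def coeff_row)
    also have "\<dots> = (if j = 0 then 0 else coeff (row f) (j - 1))
        - coeff (row f) (n - 1) * coeff F j"
      using j n by (cases j) (simp_all add: sum_subtractf sum_negf)
    finally show ?thesis
      by simp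
  qed
  have "F dvd f - row f" for f
  proof (induction f)
    case 0
    show ?case
      by (simp add: row_def n)
  next
    case (pCons a f)
    define e where "e = coeff (row f) (n - 1)"
    have "coeff (pCons a (row f) - row (pCons a f)) i = coeff (smult e F) i" for i
    proof -
      consider "i < n" | "i = n" | "i > n"
        by linarith
      then show ?thesis
      proof cases
        case 1
        then show ?thesis
          by (simp add: coeff_row[of "pCons a f"] step e_def coeff_pCons split: nat.split)
      next
        case 2
        then show ?thesis
          using monic deg n by (cases n) (simp_all add: coeff_row[of "pCons a f"] e_def)
      next
        case 3
        then show ?thesis
          using deg by (cases i) (simp_all add: coeff_row coeff_eq_0)
      qed
    qed
    then have e: "pCons a (row f) - row (pCons a f) = smult e F"
      by (simp add: poly_eq_iff)
    have "pCons a f - row (pCons a f)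
        = (pCons a f - pCons a (row f)) + (pCons a (row f) - row (pCons a f))"
      by simp
    also have "\<dots> = pCons 0 (f - row f) + smult e F"
      unfolding e by simp
    finally have "pCons a f - row (pCons a f) = pCons 0 (f - row f) + smult e F" .
    moreover have "F dvd pCons 0 (f - row f)"
      using pCons.IH dvd_mult[of F "f - row f" "[:0, 1:]"] by simp
    ultimately show ?case
      by (simp add: dvd_smult)
  qed
  then show "\<forall>f. F dvd f - (\<Sum>j<n. monom (mat_eval n f D $$ (0, j)) j)"
    by (simp add: row_def)
qed

text \<open>
  The coefficients of the remainder of $f$ modulo $F$ are entries of $f(D)$ for a single matrix $D$,
  so $c$ divides them.
\<close>

lemma monic_dvd_mod_if_mat_eval_dvd:
  fixes f :: "'a::comm_ring_1 poly"
  assumes null: "\<And>A i j. A \<in> carrier_mat n n \<Longrightarrow> i < n \<Longrightarrow> j < n \<Longrightarrow> c dvd mat_eval n f A $$ (i, j)"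
    and F: "monic F" "degree F = n" and n: "n > 0"
  shows "\<exists>g h. f = F * g + smult c h"
proof -
  obtain D where D: "D \<in> carrier_mat n n"
    and dvd: "F dvd f - (\<Sum>j<n. monom (mat_eval n f D $$ (0, j)) j)"
    using ex_monic_divisor_mod_mat_eval_row[OF F n] by blast
  from dvd obtain g where g: "f - (\<Sum>j<n. monom (mat_eval n f D $$ (0, j)) j) = F * g" ..
  have "[:c:] dvd (\<Sum>j<n. monom (mat_eval n f D $$ (0, j)) j)"
  proof (rule dvd_sum)
    fix j assume "j \<in> {..<n}"
    then have "c dvd mat_eval n f D $$ (0, j)"
      using null[OF D n] by simp
    then obtain b where "mat_eval n f D $$ (0, j) = c * b" ..
    then have "monom (mat_eval n f D $$ (0, j)) j = [:c:] * monom b j"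
      by (simp add: smult_monom)
    then show "[:c:] dvd monom (mat_eval n f D $$ (0, j)) j" ..
  qed
  then obtain h where "(\<Sum>j<n. monom (mat_eval n f D $$ (0, j)) j) = [:c:] * h" ..
  then have "f = F * g + smult c h"
    using g by (simp add: diff_eq_eq)
  then show ?thesis
    by blast
qed

lemma det_eq_0_if_zero_row:
  fixes B :: "'a::comm_ring_1 mat"
  assumes "B \<in> carrier_mat n n" "i < n" "\<And>j. j < n \<Longrightarrow> B $$ (i, j) = 0"
  shows "det B = 0"
  using laplace_expansion_row[OF assms(1,2)] assms(3) by simp

text \<open>
  The $j$-th columns of $A^0, \dots, A^n$ are linearly dependent; the extra zero row makes their
  matrix square and its determinant zero.
\<close>

lemma ex_poly_annihilating_column:
  fixes A :: "'f::field mat"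
  assumes A: "A \<in> carrier_mat n n" and j: "j < n"
  shows "\<exists>f. f \<noteq> 0 \<and> degree f \<le> n \<and> (\<forall>i<n. mat_eval n f A $$ (i, j) = 0)"
proof -
  define B where "B = mat (Suc n) (Suc n) (\<lambda>(i, m). if i < n then (A ^\<^sub>m m) $$ (i, j) else 0)"
  have B: "B \<in> carrier_mat (Suc n) (Suc n)"
    by (simp add: B_def)
  have "det B = 0"
    by (rule det_eq_0_if_zero_row[OF B, of n]) (simp_all add: B_def)
  then obtain v where v: "v \<in> carrier_vec (Suc n)" "v \<noteq> 0\<^sub>v (Suc n)"
    and Bv: "B *\<^sub>v v = 0\<^sub>v (Suc n)"
    using det_0_iff_vec_prod_zero_field[OF B] by blast
  define f where "f = (\<Sum>m\<le>n. monom (v $ m) m)"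
  have coeff_f: "coeff f m = (if m \<le> n then v $ m else 0)" for m
    by (simp add: f_def coeff_sum)
  have deg: "degree f \<le> n"
    by (rule degree_le) (simp add: coeff_f)
  have "f \<noteq> 0"
  proof
    assume "f = 0"
    then have "v $ m = 0" if "m < Suc n" for m
      using coeff_f[of m] that by simp
    then show False
      using v by auto
  qed
  moreover have "mat_eval n f A $$ (i, j) = 0" if i: "i < n" for i
  proof -
    have "mat_eval n f A $$ (i, j) = (\<Sum>m\<le>n. v $ m * (A ^\<^sub>m m) $$ (i, j))"
      by (simp add: index_mat_eval[OF i j deg] coeff_f)
    also have "\<dots> = (B *\<^sub>v v) $ i"
      using i v(1) by (simp add: B_def scalar_prod_def lessThan_Suc_atMost[symmetric]
          lessThan_atLeast0 mult.commute)
    finally show ?thesis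
      using i by (simp add: Bv)
  qed
  ultimately show ?thesis
    using deg by blast
qed

text \<open>
  Each column is treated separately: the polynomial annihilating it divides $\Phi$.
\<close>

lemma mat_eval_Phi_eq_0:
  fixes A :: "'f::field_gcd mat"
  assumes fin: "finite (UNIV :: 'f set)" and A: "A \<in> carrier_mat n n"
  shows "mat_eval n (Phi CARD('f) n) A = 0\<^sub>m n n"
proof (intro eq_matI)
  fix i j assume "i < dim_row (0\<^sub>m n n :: 'f mat)" "j < dim_col (0\<^sub>m n n :: 'f mat)"
  then have ij: "i < n" "j < n"
    by simp_all
  obtain f where f: "f \<noteq> 0" "degree f \<le> n" "\<forall>i<n. mat_eval n f A $$ (i, j) = 0"
    using ex_poly_annihilating_column[OF A ij(2)] by blast
  obtain g where "Phi CARD('f) n = f * g"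
    using dvd_Phi_if_degree_le[OF fin f(1,2)] ..
  then have "mat_eval n (Phi CARD('f) n) A = mat_eval n g A * mat_eval n f A"
    by (simp add: mat_eval_mult[OF A] mult.commute[of f])
  then have "mat_eval n (Phi CARD('f) n) A $$ (i, j)
      = (\<Sum>l<n. mat_eval n g A $$ (i, l) * mat_eval n f A $$ (l, j))"
    by (simp only: index_mult_mat_sum[OF mat_eval_carrier mat_eval_carrier ij])
  then show "mat_eval n (Phi CARD('f) n) A $$ (i, j) = 0\<^sub>m n n $$ (i, j)"
    using f(3) ij by simp
qed (simp_all add: mat_eval_def)

lemma dvd_mat_eval_mult:
  fixes A :: "'a::comm_ring_1 mat"
  assumes A: "A \<in> carrier_mat n n"
    and f: "\<And>i j. i < n \<Longrightarrow> j < n \<Longrightarrow> c dvd mat_eval n f A $$ (i, j)"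
    and g: "\<And>i j. i < n \<Longrightarrow> j < n \<Longrightarrow> d dvd mat_eval n g A $$ (i, j)"
    and ij: "i < n" "j < n"
  shows "c * d dvd mat_eval n (f * g) A $$ (i, j)"
proof -
  have "mat_eval n (f * g) A $$ (i, j)
      = (\<Sum>l<n. mat_eval n f A $$ (i, l) * mat_eval n g A $$ (l, j))"
    unfolding mat_eval_mult[OF A] by (rule index_mult_mat_sum[OF mat_eval_carrier mat_eval_carrier ij])
  also have "c * d dvd \<dots>"
    using f g ij by (intro dvd_sum mult_dvd_mono) auto
  finally show ?thesis .
qed

lemma dvd_mat_eval_sum:
  fixes A :: "'a::comm_ring_1 mat"
  assumes "\<And>x. x \<in> S \<Longrightarrow> c dvd mat_eval n (f x) A $$ (i, j)" "i < n" "j < n"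
  shows "c dvd mat_eval n (sum f S) A $$ (i, j)"
proof -
  have "mat_eval n (sum f S) A $$ (i, j) = (\<Sum>x\<in>S. mat_eval n (f x) A $$ (i, j))"
    using assms(2,3) by (induction S rule: infinite_finite_induct) (simp_all add: mat_eval_add)
  then show ?thesis
    using assms(1) by (simp add: dvd_sum)
qed

section \<open>Polynomials over a ring with a finite residue field\<close>

lemma diff_dvd_power_diff:
  fixes a b :: "'a::comm_ring_1"
  shows "a - b dvd a ^ i - b ^ i"
proof (induction i)
  case (Suc i)
  have "a ^ Suc i - b ^ Suc i = a * (a ^ i - b ^ i) + (a - b) * b ^ i"
    by (simp add: algebra_simps)
  then show ?case
    using Suc by simp
qed simp

lemma prime_power_dvd_cancel:
  fixes p :: "'a::semiring_gcd"
  assumes "prime_elem p" "\<not> p dvd u" "p ^ e dvd u * x"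
  shows "p ^ e dvd x"
proof -
  have "coprime (p ^ e) u"
    using prime_elem_imp_power_coprime[OF assms(1,2)] by (simp add: coprime_commute)
  then show ?thesis
    using assms(3) by (simp add: coprime_dvd_mult_right_iff)
qed

lemma monic_if_prime:
  fixes p :: "'f::field_gcd poly"
  assumes "prime p"
  shows "monic p"
proof -
  have "p \<noteq> 0"
    using assms by auto
  then have "unit_factor (lead_coeff p) = lead_coeff p"
    by (intro is_unit_unit_factor) (simp add: dvd_field_iff)
  moreover have "[:unit_factor (lead_coeff p):] = 1"
    using unit_factor_prime[OF assms] by (simp add: unit_factor_poly_def)
  ultimately show ?thesis
    by (simp add: one_pCons)
qed

lemma (in comm_ring_hom) ex_lift_poly:
  assumes surj: "surj hom"
  shows "\<exists>F. map_poly hom F = f \<and> degree F = degree f"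
proof (induction f)
  case 0
  show ?case
    by (rule exI[of _ 0]) simp
next
  case (pCons a f)
  obtain b where b: "hom b = a"
    using surj by (metis surjD)
  obtain F where F: "map_poly hom F = f" "degree F = degree f"
    using pCons.IH by blast
  show ?case
  proof (cases "f = 0")
    case True
    then show ?thesis
      using b by (intro exI[of _ "[:b:]"]) (simp add: map_poly_pCons_hom)
  next
    case False
    then have "F \<noteq> 0"
      using F(1) by auto
    then show ?thesis
      using b F False by (intro exI[of _ "pCons b F"]) (simp add: map_poly_pCons_hom)
  qed
qed

text \<open>
  The setting of a discrete valuation ring, reduced to what the argument uses: a surjection onto a
  finite field whose kernel is generated by one nonzero element \<open>\<tau>\<close>.  The residue field is a type of
  its own so that factorization of polynomials over it is available.
\<close>

locale finite_residue_map = comm_ring_hom \<rho> for \<rho> :: "'v::idom \<Rightarrow> 'f::field_gcd" +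
  fixes \<tau> :: 'v
  assumes residue_surj: "surj \<rho>"
    and residue_eq_0_iff: "\<rho> x = 0 \<longleftrightarrow> \<tau> dvd x"
    and uniformizer_neq_0: "\<tau> \<noteq> 0"
    and finite_residues: "finite (UNIV :: 'f set)"
begin

sublocale residue_poly: map_poly_comm_ring_hom \<rho> ..

lemma map_poly_residue_eq_0_iff: "map_poly \<rho> f = 0 \<longleftrightarrow> [:\<tau>:] dvd f"
  by (simp add: poly_eq_iff const_poly_dvd_iff residue_eq_0_iff)

lemma ex_monic_lift_poly:
  assumes "monic f"
  shows "\<exists>F. map_poly \<rho> F = f \<and> degree F = degree f \<and> monic F"
proof (cases "degree f = 0")
  case True
  then have "f = 1"
    using assms by (metis degree_eq_zeroE coeff_pCons_0 one_pCons)
  then show ?thesis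
    by (intro exI[of _ 1]) simp
next
  case False
  define d where "d = degree f"
  obtain G where G: "map_poly \<rho> G = f - monom 1 d" "degree G = degree (f - monom 1 d)"
    using ex_lift_poly[OF residue_surj, of "f - monom 1 d"] by blast
  have "degree (f - monom 1 d) < d"
    using False assms
    by (intro degree_lessI) (auto simp: d_def coeff_eq_0 le_less)
  then have deg: "degree G < degree (monom 1 d :: 'v poly)"
    by (simp add: G(2) degree_monom_eq)
  have "degree (G + monom 1 d) = d"
    using degree_add_eq_right[OF deg] by (simp add: degree_monom_eq)
  moreover have "coeff G d = 0"
    using deg by (intro coeff_eq_0) (simp add: degree_monom_eq)
  moreover have "map_poly \<rho> (G + monom 1 d) = f"
    by (simp add: G(1) hom_distribs)
  ultimately show ?thesis
    by (intro exI[of _ "G + monom 1 d"]) (simp add: d_def)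
qed

text \<open>
  The generator \<open>\<tau>\<close> is a prime element of the polynomial ring, since the quotient by it is a
  polynomial ring over a field, and it does not divide a monic polynomial.
\<close>

lemma monic_dvd_cancel_uniformizer_power:
  assumes D: "monic D" and dvd: "D dvd smult (\<tau> ^ k) b"
  shows "D dvd b"
  using dvd
proof (induction k arbitrary: b)
  case 0
  then show ?case
    by simp
next
  case (Suc k)
  then have "D dvd smult (\<tau> ^ k) (smult \<tau> b)"
    by (simp add: mult.commute)
  then have "D dvd smult \<tau> b"
    by (rule Suc.IH)
  then obtain a where a: "smult \<tau> b = D * a" ..
  have "map_poly \<rho> D * map_poly \<rho> a = map_poly \<rho> (smult \<tau> b)"
    by (simp add: a hom_distribs)
  also have "\<dots> = 0"
    unfolding map_poly_residue_eq_0_iff by (rule dvdI[of _ _ b]) simp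
  finally have "map_poly \<rho> D = 0 \<or> map_poly \<rho> a = 0"
    by simp
  moreover have "coeff (map_poly \<rho> D) (degree D) = 1"
    using D by simp
  ultimately have "[:\<tau>:] dvd a"
    unfolding map_poly_residue_eq_0_iff[symmetric] by fastforce
  then obtain c where "a = [:\<tau>:] * c" ..
  then have "smult \<tau> b = smult \<tau> (D * c)"
    using a by simp
  then have "b = D * c"
    using uniformizer_neq_0 by (simp add: smult_cancel)
  then show ?case ..
qed

lemma map_poly_residue_Phi: "map_poly \<rho> (Phi q n) = Phi q n"
  by (simp add: Phi_def hom_distribs)

text \<open>
  Modulo $D$ one has $\Phi = \tau (c U + W)$, which turns the sum into \<open>\<tau> ^ k\<close> times the sum in the
  conclusion.  In the application $E$ is a power of a lifted irreducible polynomial.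
\<close>

lemma dvd_sum_powers_of_Phi_reparametrised:
  assumes PW: "Phi q n = E * U + smult \<tau> W"
    and D: "D = E - [:\<tau> * c:]" and monic: "monic D"
    and f: "D dvd (\<Sum>i\<le>k. smult (\<tau> ^ (k - i)) (h i * Phi q n ^ i)) - smult (\<tau> ^ Suc k) h'"
  shows "D dvd (\<Sum>i\<le>k. h i * (smult c U + W) ^ i) - smult \<tau> h'"
proof -
  define Y where "Y = smult c U + W"
  have Phi: "Phi q n - smult \<tau> Y = D * U"
    by (simp add: PW D Y_def algebra_simps smult_add_right)
  have "D dvd (\<Sum>i\<le>k. smult (\<tau> ^ (k - i)) (h i * Phi q n ^ i)) - smult (\<tau> ^ k) (\<Sum>i\<le>k. h i * Y ^ i)"
  proof -
    have "(\<Sum>i\<le>k. smult (\<tau> ^ (k - i)) (h i * Phi q n ^ i)) - smult (\<tau> ^ k) (\<Sum>i\<le>k. h i * Y ^ i)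
        = (\<Sum>i\<le>k. smult (\<tau> ^ (k - i)) (h i * (Phi q n ^ i - smult \<tau> Y ^ i)))"
      unfolding smult_sum2 sum_subtractf[symmetric]
      by (intro sum.cong refl) (simp add: smult_power smult_diff_right right_diff_distrib
          power_add[symmetric])
    also have "D dvd \<dots>"
    proof (intro dvd_sum dvd_smult dvd_mult)
      fix i
      have "D dvd Phi q n - smult \<tau> Y"
        unfolding Phi by simp
      then show "D dvd Phi q n ^ i - smult \<tau> Y ^ i"
        by (rule dvd_trans[OF _ diff_dvd_power_diff])
    qed
    finally show ?thesis .
  qed
  from dvd_diff[OF f this]
  have "D dvd smult (\<tau> ^ k) ((\<Sum>i\<le>k. h i * Y ^ i) - smult \<tau> h')"
    by (simp add: smult_diff_right algebra_simps)
  then show ?thesis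
    unfolding Y_def by (rule monic_dvd_cancel_uniformizer_power[OF monic])
qed

text \<open>
  Divisibility is checked one irreducible polynomial $p$ at a time.  The constant $c$ in the modulus
  $P^e - \tau c$ is free, and its $q$ residues give $q$ points at which a polynomial of degree at most
  $k < q$ vanishes modulo $p^e$.
\<close>

lemma Phi_dvd_residues_of_coefficients:
  assumes q: "q = CARD('f)" and k: "k < q" and i: "i \<le> k"
    and f: "\<And>F. monic F \<Longrightarrow> degree F = n \<Longrightarrow>
      \<exists>g h'. (\<Sum>i\<le>k. smult (\<tau> ^ (k - i)) (h i * Phi q n ^ i)) = F * g + smult (\<tau> ^ Suc k) h'"
  shows "Phi q n dvd map_poly \<rho> (h i)"
proof -
  have Phi_nz: "Phi q n \<noteq> (0 :: 'f poly)"
    unfolding q by (rule Phi_card_neq_0[OF finite_residues])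
  show ?thesis
  proof (cases "map_poly \<rho> (h i) = 0")
    case nonzero: False
    show ?thesis
    proof (rule multiplicity_le_imp_dvd[OF Phi_nz])
      fix p :: "'f poly" assume "prime p"
      then have p: "prime_elem p"
        by simp
      define e where "e = multiplicity p (Phi q n)"
      have e: "e = n div degree p"
        using multiplicity_Phi[OF finite_residues p] by (simp add: e_def q)
      show "multiplicity p (Phi q n) \<le> multiplicity p (map_poly \<rho> (h i))"
      proof (cases "e = 0")
        case True
        then show ?thesis
          by (simp add: e_def)
      next
        case False
        obtain u where u: "Phi q n = p ^ e * u" "\<not> p dvd u"
          using multiplicity_decompose'[OF Phi_nz prime_elem_not_unit[OF p]] unfolding e_def by metis
        obtain P where P: "map_poly \<rho> P = p" "degree P = degree p" "monic P"
          using ex_monic_lift_poly[OF monic_if_prime[OF \<open>prime p\<close>]] by blast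
        obtain U where U: "map_poly \<rho> U = u"
          using ex_lift_poly[OF residue_surj] by blast
        have "map_poly \<rho> (Phi q n - P ^ e * U) = 0"
          by (simp add: hom_distribs map_poly_residue_Phi u(1) P(1) U)
        then obtain W where "Phi q n - P ^ e * U = [:\<tau>:] * W"
          unfolding map_poly_residue_eq_0_iff ..
        then have PW: "Phi q n = P ^ e * U + smult \<tau> W"
          by (simp add: diff_eq_eq add.commute)
        have "P \<noteq> 0"
          using P(3) by auto
        then have degP: "degree (P ^ e) = e * degree p"
          by (simp add: degree_power_eq P(2))
        have monicP: "monic (P ^ e)"
          using P(3) by (rule monic_power)
        have pos: "degree (P ^ e) > 0"
          using False degree_prime_elem_pos[OF p] by (simp add: degP)
        have le: "degree (P ^ e) \<le> n"
          unfolding degP unfolding e by simp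
        have key: "p ^ e dvd (\<Sum>i\<le>k. map_poly \<rho> (h i) * (smult a u + map_poly \<rho> W) ^ i)" for a
        proof -
          obtain c where c: "\<rho> c = a"
            using residue_surj by (metis surjD)
          \<comment> \<open>It reduces to $p^e$, and modulo it $\Phi$ is \<open>\<tau>\<close> times a lift of $a u + w$.\<close>
          define D where "D = P ^ e - [:\<tau> * c:]"
          have degD: "degree D = degree (P ^ e)"
            unfolding D_def diff_conv_add_uminus using pos by (intro degree_add_eq_left) simp
          have monicD: "monic D"
            unfolding degD using pos monicP by (simp add: D_def coeff_pCons split: nat.split)
          then have "D \<noteq> 0"
            by auto
          \<comment> \<open>Padding with a power of $x$ reaches the degree $n$ required by the hypothesis.\<close>
          have "monic (D * monom 1 (n - degree D))"
            using monicD by (intro monic_mult) (simp_all add: degree_monom_eq)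
          moreover have "degree (D * monom 1 (n - degree D)) = n"
            using \<open>D \<noteq> 0\<close> le by (subst degree_mult_eq) (simp_all add: degree_monom_eq degD)
          ultimately obtain g h' where
            "(\<Sum>i\<le>k. smult (\<tau> ^ (k - i)) (h i * Phi q n ^ i))
              = D * monom 1 (n - degree D) * g + smult (\<tau> ^ Suc k) h'"
            using f by blast
          then have "D dvd (\<Sum>i\<le>k. smult (\<tau> ^ (k - i)) (h i * Phi q n ^ i)) - smult (\<tau> ^ Suc k) h'"
            by (simp add: mult.assoc)
          then have "D dvd (\<Sum>i\<le>k. h i * (smult c U + W) ^ i) - smult \<tau> h'"
            by (rule dvd_sum_powers_of_Phi_reparametrised[OF PW D_def monicD])
          then have "map_poly \<rho> D dvd map_poly \<rho> ((\<Sum>i\<le>k. h i * (smult c U + W) ^ i) - smult \<tau> h')"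
            by (rule residue_poly.hom_dvd)
          moreover have "\<rho> \<tau> = 0"
            by (simp add: residue_eq_0_iff)
          ultimately show ?thesis
            by (simp add: D_def hom_distribs P(1) U c)
        qed
        define T where "T = range (\<lambda>a. smult a u + map_poly \<rho> W)"
        have "u \<noteq> 0"
          using u(2) by auto
        have "inj (\<lambda>a. smult a u + map_poly \<rho> W)"
        proof (rule injI)
          fix a b assume "smult a u + map_poly \<rho> W = smult b u + map_poly \<rho> W"
          then have "smult (a - b) u = 0"
            by (simp add: smult_diff_left)
          then show "a = b"
            using \<open>u \<noteq> 0\<close> by simp
        qed
        then have cardT: "card T = q" and finT: "finite T"
          using finite_residues by (simp_all add: T_def card_image q)
        define Q where "Q = (\<Sum>i\<le>k. monom (map_poly \<rho> (h i)) i)"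
        have "p ^ e dvd coeff Q i"
        proof (rule dvd_coeff_if_dvd_poly_at_many[OF finT])
          have "degree Q \<le> k"
            by (rule degree_le) (simp add: Q_def coeff_sum)
          then show "degree Q < card T"
            using k by (simp add: cardT)
          show "p ^ e dvd poly Q t" if "t \<in> T" for t
            using that key by (auto simp: T_def Q_def poly_sum poly_monom)
          show "p ^ e dvd x" if st: "s \<in> T" "t \<in> T" "s \<noteq> t" and dvd: "p ^ e dvd (s - t) * x" for s t x
          proof -
            obtain a b where ab: "s = smult a u + map_poly \<rho> W" "t = smult b u + map_poly \<rho> W"
              using st(1,2) unfolding T_def by blast
            then have "s - t = smult (a - b) u" "a \<noteq> b"
              using st(3) by (auto simp: smult_diff_left)
            then have "\<not> p dvd s - t"
              using u(2) by (simp add: dvd_smult_iff)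
            then show ?thesis
              using dvd by (rule prime_power_dvd_cancel[OF p])
          qed
        qed
        moreover have "coeff Q i = map_poly \<rho> (h i)"
          using i by (simp add: Q_def coeff_sum)
        ultimately show ?thesis
          using nonzero prime_elem_not_unit[OF p] unfolding e_def[symmetric]
          by (intro multiplicity_geI) auto
      qed
    qed
  qed simp
qed

text \<open>
  Once $h_i = \Phi A_i + \tau B_i$, the part $A_i$ moves to the next power of $\Phi$ and the part $B_i$
  gains a factor \<open>\<tau>\<close>.
\<close>

lemma ex_sum_powers_of_Phi:
  assumes q: "q = CARD('f)" and k: "k \<le> q"
    and f: "\<And>F. monic F \<Longrightarrow> degree F = n \<Longrightarrow> \<exists>g h. f = F * g + smult (\<tau> ^ k) h"
  shows "\<exists>h. f = (\<Sum>i\<le>k. smult (\<tau> ^ (k - i)) (h i * Phi q n ^ i))"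
  using k f
proof (induction k)
  case 0
  show ?case
    by (intro exI[of _ "\<lambda>_. f"]) simp
next
  case (Suc k)
  have "\<exists>g h. f = F * g + smult (\<tau> ^ k) h" if F: "monic F" "degree F = n" for F
  proof -
    obtain g h where "f = F * g + smult (\<tau> ^ Suc k) h"
      using Suc.prems(2)[OF F] by blast
    then have "f = F * g + smult (\<tau> ^ k) (smult \<tau> h)"
      by (simp add: mult.commute)
    then show ?thesis
      by blast
  qed
  then obtain h where h: "f = (\<Sum>i\<le>k. smult (\<tau> ^ (k - i)) (h i * Phi q n ^ i))"
    using Suc.IH[OF Suc_leD[OF Suc.prems(1)]] by blast
  have "\<exists>A B. h i = Phi q n * A + smult \<tau> B" if i: "i \<le> k" for i
  proof -
    have "Phi q n dvd map_poly \<rho> (h i)"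
      using Suc.prems unfolding h
      by (intro Phi_dvd_residues_of_coefficients[OF q _ i]) auto
    then obtain a where a: "map_poly \<rho> (h i) = Phi q n * a" ..
    obtain A where "map_poly \<rho> A = a"
      using ex_lift_poly[OF residue_surj] by blast
    then have "map_poly \<rho> (h i - Phi q n * A) = 0"
      by (simp add: hom_distribs map_poly_residue_Phi a)
    then obtain B where "h i - Phi q n * A = [:\<tau>:] * B"
      unfolding map_poly_residue_eq_0_iff ..
    then have "h i = Phi q n * A + smult \<tau> B"
      by (simp add: diff_eq_eq add.commute)
    then show ?thesis
      by blast
  qed
  then have "\<forall>i. \<exists>A B. i \<le> k \<longrightarrow> h i = Phi q n * A + smult \<tau> B"
    by blast
  from choice[OF this] obtain A where "\<forall>i. \<exists>B. i \<le> k \<longrightarrow> h i = Phi q n * A i + smult \<tau> B" ..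
  from choice[OF this] obtain B where "\<forall>i. i \<le> k \<longrightarrow> h i = Phi q n * A i + smult \<tau> (B i)" ..
  then have AB: "h i = Phi q n * A i + smult \<tau> (B i)" if "i \<le> k" for i
    using that by blast
  \<comment> \<open>$A_i \Phi^{i+1}$ belongs to the power $i + 1$, and $B_i \Phi^i$ stays with the power $i$.\<close>
  define h' where "h' i = (if i = 0 then 0 else A (i - 1)) + (if i \<le> k then B i else 0)" for i
  let ?m = "\<lambda>c i. smult (\<tau> ^ (Suc k - i)) (c * Phi q n ^ i)"
  have "f = (\<Sum>i\<le>k. ?m (A i) (Suc i) + ?m (B i) i)"
    unfolding h
  proof (intro sum.cong refl)
    fix i assume "i \<in> {..k}"
    then show "smult (\<tau> ^ (k - i)) (h i * Phi q n ^ i) = ?m (A i) (Suc i) + ?m (B i) i"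
      by (simp add: AB Suc_diff_le algebra_simps smult_add_right)
  qed
  also have "\<dots> = (\<Sum>i\<le>Suc k. ?m (if i = 0 then 0 else A (i - 1)) i)
      + (\<Sum>i\<le>Suc k. ?m (if i \<le> k then B i else 0) i)"
  proof -
    have "(\<Sum>i\<le>Suc k. ?m (if i = 0 then 0 else A (i - 1)) i) = (\<Sum>i\<le>k. ?m (A i) (Suc i))"
      by (simp add: sum.atMost_Suc_shift del: sum.atMost_Suc)
    moreover have "(\<Sum>i\<le>Suc k. ?m (if i \<le> k then B i else 0) i) = (\<Sum>i\<le>k. ?m (B i) i)"
      by simp
    ultimately show ?thesis
      by (simp only: sum.distrib)
  qed
  also have "\<dots> = (\<Sum>i\<le>Suc k. ?m (h' i) i)"
    by (simp only: sum.distrib[symmetric] h'_def distrib_right smult_add_right)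
  finally show ?case
    by blast
qed

text \<open>
  Over the residue field $\Phi$ annihilates the reduction of $A$.
\<close>

lemma uniformizer_dvd_mat_eval_Phi:
  assumes A: "A \<in> carrier_mat n n" and ij: "i < n" "j < n"
  shows "\<tau> dvd mat_eval n (Phi CARD('f) n) A $$ (i, j)"
proof -
  have "map_mat \<rho> (mat_eval n (Phi CARD('f) n) A) = mat_eval n (Phi CARD('f) n) (map_mat \<rho> A)"
    unfolding mat_eval_map_poly[OF comm_ring_hom_axioms A, symmetric] map_poly_residue_Phi ..
  also have "\<dots> = 0\<^sub>m n n"
    using A by (intro mat_eval_Phi_eq_0[OF finite_residues]) simp
  finally have "map_mat \<rho> (mat_eval n (Phi CARD('f) n) A) $$ (i, j) = 0\<^sub>m n n $$ (i, j)"
    by simp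
  then show ?thesis
    using ij by (simp add: residue_eq_0_iff)
qed

lemma uniformizer_power_dvd_mat_eval_sum_powers_of_Phi:
  assumes A: "A \<in> carrier_mat n n" and q: "q = CARD('f)" and ij: "i < n" "j < n"
  shows "\<tau> ^ k dvd
    mat_eval n (\<Sum>m\<le>k. smult (\<tau> ^ (k - m)) (h m * Phi q n ^ m)) A $$ (i, j)"
proof (intro dvd_mat_eval_sum ij)
  fix m assume m: "m \<in> {..k}"
  have pow: "\<tau> ^ m dvd mat_eval n (Phi q n ^ m) A $$ (i, j)" if "i < n" "j < n" for m i j
    using that
  proof (induction m arbitrary: i j)
    case (Suc m)
    have "\<tau> * \<tau> ^ m dvd mat_eval n (Phi q n * Phi q n ^ m) A $$ (i, j)"
      using uniformizer_dvd_mat_eval_Phi[OF A] Suc unfolding q by (intro dvd_mat_eval_mult[OF A])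
    then show ?case
      by simp
  qed simp
  have "1 * \<tau> ^ m dvd mat_eval n (h m * Phi q n ^ m) A $$ (i, j)"
    using pow ij by (intro dvd_mat_eval_mult[OF A]) auto
  then have "\<tau> ^ (k - m) * \<tau> ^ m dvd \<tau> ^ (k - m) * mat_eval n (h m * Phi q n ^ m) A $$ (i, j)"
    by (intro mult_dvd_mono) simp_all
  then show "\<tau> ^ k dvd mat_eval n (smult (\<tau> ^ (k - m)) (h m * Phi q n ^ m)) A $$ (i, j)"
    using m ij by (simp add: mat_eval_smult power_add[symmetric])
qed

text \<open>
  The null ideal of the matrices, pulled back to polynomials over the ring itself: the sums on the
  right-hand side form the ideal $(\Phi, \tau)^k$.
\<close>

theorem uniformizer_power_dvd_mat_eval_iff:
  assumes q: "q = CARD('f)" and k: "k \<le> q" and n: "n > 0"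
  shows "(\<forall>A\<in>carrier_mat n n. \<forall>i<n. \<forall>j<n. \<tau> ^ k dvd mat_eval n f A $$ (i, j)) \<longleftrightarrow>
    (\<exists>h. f = (\<Sum>m\<le>k. smult (\<tau> ^ (k - m)) (h m * Phi q n ^ m)))"
proof
  assume null: "\<forall>A\<in>carrier_mat n n. \<forall>i<n. \<forall>j<n. \<tau> ^ k dvd mat_eval n f A $$ (i, j)"
  show "\<exists>h. f = (\<Sum>m\<le>k. smult (\<tau> ^ (k - m)) (h m * Phi q n ^ m))"
  proof (rule ex_sum_powers_of_Phi[OF q k])
    fix F :: "'v poly" assume F: "monic F" "degree F = n"
    show "\<exists>g h. f = F * g + smult (\<tau> ^ k) h"
      by (rule monic_dvd_mod_if_mat_eval_dvd[OF _ F n]) (use null in blast)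
  qed
next
  assume "\<exists>h. f = (\<Sum>m\<le>k. smult (\<tau> ^ (k - m)) (h m * Phi q n ^ m))"
  then show "\<forall>A\<in>carrier_mat n n. \<forall>i<n. \<forall>j<n. \<tau> ^ k dvd mat_eval n f A $$ (i, j)"
    using uniformizer_power_dvd_mat_eval_sum_powers_of_Phi[OF _ q] by blast
qed

end

section \<open>Ideals with finitely many generators\<close>

lemma is_ideal_ideal_gen: "is_ideal (ideal_gen S)"
  by (auto simp: ideal_gen_def is_ideal_def)

lemma ideal_gen_superset: "S \<subseteq> ideal_gen S"
  by (auto simp: ideal_gen_def)

lemma ideal_gen_minimal: "is_ideal I \<Longrightarrow> S \<subseteq> I \<Longrightarrow> ideal_gen S \<subseteq> I"
  by (auto simp: ideal_gen_def)

text \<open>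
  Both inclusions are formal; for the first, the elements $x$ with $x y$ in a given ideal form an
  ideal, which is applied in each factor in turn.
\<close>

lemma ideal_mult_ideal_gen:
  fixes S T :: "'a::comm_ring_1 set"
  shows "ideal_mult (ideal_gen S) (ideal_gen T) = ideal_gen {s * t | s t. s \<in> S \<and> t \<in> T}"
    (is "_ = ideal_gen ?ST")
proof
  have ideal: "is_ideal {x. x * y \<in> ideal_gen ?ST}" for y
    using is_ideal_ideal_gen[of ?ST] by (simp add: is_ideal_def distrib_right mult.assoc)
  have S: "x * t \<in> ideal_gen ?ST" if "x \<in> ideal_gen S" "t \<in> T" for x t
  proof -
    have "S \<subseteq> {x. x * t \<in> ideal_gen ?ST}"
      using ideal_gen_superset[of ?ST] \<open>t \<in> T\<close> by blast
    then show ?thesis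
      using ideal_gen_minimal[OF ideal] \<open>x \<in> ideal_gen S\<close> by blast
  qed
  have "x * y \<in> ideal_gen ?ST" if "x \<in> ideal_gen S" "y \<in> ideal_gen T" for x y
  proof -
    have "T \<subseteq> {y. y * x \<in> ideal_gen ?ST}"
      using S[OF \<open>x \<in> ideal_gen S\<close>] by (auto simp: mult.commute)
    then have "y * x \<in> ideal_gen ?ST"
      using ideal_gen_minimal[OF ideal] \<open>y \<in> ideal_gen T\<close> by blast
    then show ?thesis
      by (simp add: mult.commute)
  qed
  then show "ideal_mult (ideal_gen S) (ideal_gen T) \<subseteq> ideal_gen ?ST"
    unfolding ideal_mult_def by (intro ideal_gen_minimal is_ideal_ideal_gen) blast
  have "?ST \<subseteq> {a * b | a b. a \<in> ideal_gen S \<and> b \<in> ideal_gen T}"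
    using ideal_gen_superset[of S] ideal_gen_superset[of T] by blast
  then show "ideal_gen ?ST \<subseteq> ideal_mult (ideal_gen S) (ideal_gen T)"
    unfolding ideal_mult_def using ideal_gen_superset
    by (intro ideal_gen_minimal is_ideal_ideal_gen) blast
qed

lemma ideal_power_ideal_gen_pair:
  fixes a b :: "'a::comm_ring_1"
  shows "ideal_power (ideal_gen {a, b}) k = ideal_gen {b ^ i * a ^ (k - i) | i. i \<le> k}"
proof (induction k)
  case 0
  have "{b ^ i * a ^ (0 - i) | i. i \<le> 0} = {1}"
    by auto
  then show ?case
    by (simp only: ideal_power.simps ideal_gen_singleton one_dvd) simp
next
  case (Suc k)
  have "{s * t | s t. s \<in> {a, b} \<and> t \<in> {b ^ i * a ^ (k - i) | i. i \<le> k}}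
      = {b ^ i * a ^ (Suc k - i) | i. i \<le> Suc k}" (is "?L = ?R")
  proof
    have "a * (b ^ i * a ^ (k - i)) \<in> ?R" if "i \<le> k" for i
      using that by (auto intro!: exI[of _ i] simp: Suc_diff_le mult_ac)
    moreover have "b * (b ^ i * a ^ (k - i)) \<in> ?R" if "i \<le> k" for i
      using that by (auto intro!: exI[of _ "Suc i"] simp: mult_ac)
    ultimately show "?L \<subseteq> ?R"
      by blast
    have "b ^ i * a ^ (Suc k - i) \<in> ?L" if i: "i \<le> Suc k" for i
    proof (cases "i \<le> k")
      case True
      then have "b ^ i * a ^ (Suc k - i) = a * (b ^ i * a ^ (k - i))"
        by (simp add: Suc_diff_le mult_ac)
      then show ?thesis
        using True by blast
    next
      case False
      then have "b ^ i * a ^ (Suc k - i) = b * (b ^ k * a ^ (k - k))"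
        using i by (simp add: le_Suc_eq)
      then show ?thesis
        by blast
    qed
    then show "?R \<subseteq> ?L"
      by blast
  qed
  then show ?case
    by (simp only: ideal_power.simps Suc.IH ideal_mult_ideal_gen)
qed

lemma ideal_gen_image:
  fixes g :: "'i \<Rightarrow> 'a::comm_ring_1"
  assumes fin: "finite I"
  shows "ideal_gen (g ` I) = {x. \<exists>c. x = (\<Sum>i\<in>I. c i * g i)}"
proof
  show "ideal_gen (g ` I) \<subseteq> {x. \<exists>c. x = (\<Sum>i\<in>I. c i * g i)}"
  proof (rule ideal_gen_minimal)
    show "is_ideal {x. \<exists>c. x = (\<Sum>i\<in>I. c i * g i)}"
      unfolding is_ideal_def
    proof (intro conjI ballI allI)
      show "0 \<in> {x. \<exists>c. x = (\<Sum>i\<in>I. c i * g i)}"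
        by (auto intro!: exI[of _ "\<lambda>_. 0"])
    next
      fix x y assume "x \<in> {x. \<exists>c. x = (\<Sum>i\<in>I. c i * g i)}" "y \<in> {x. \<exists>c. x = (\<Sum>i\<in>I. c i * g i)}"
      then obtain c d where "x = (\<Sum>i\<in>I. c i * g i)" "y = (\<Sum>i\<in>I. d i * g i)"
        by blast
      then have "x + y = (\<Sum>i\<in>I. (c i + d i) * g i)"
        by (simp add: distrib_right sum.distrib)
      then show "x + y \<in> {x. \<exists>c. x = (\<Sum>i\<in>I. c i * g i)}"
        by (intro CollectI exI[of _ "\<lambda>i. c i + d i"])
    next
      fix a x assume "x \<in> {x. \<exists>c. x = (\<Sum>i\<in>I. c i * g i)}"
      then obtain c where "x = (\<Sum>i\<in>I. c i * g i)"
        by blast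
      then have "a * x = (\<Sum>i\<in>I. (a * c i) * g i)"
        by (simp add: sum_distrib_left mult.assoc)
      then show "a * x \<in> {x. \<exists>c. x = (\<Sum>i\<in>I. c i * g i)}"
        by (intro CollectI exI[of _ "\<lambda>i. a * c i"])
    qed
    have "g j \<in> {x. \<exists>c. x = (\<Sum>i\<in>I. c i * g i)}" if "j \<in> I" for j
    proof (intro CollectI exI)
      have "(\<Sum>i\<in>I. (if i = j then 1 else 0) * g i) = (\<Sum>i\<in>I. if i = j then g i else 0)"
        by (intro sum.cong) auto
      then show "g j = (\<Sum>i\<in>I. (if i = j then 1 else 0) * g i)"
        using fin that by simp
    qed
    then show "g ` I \<subseteq> {x. \<exists>c. x = (\<Sum>i\<in>I. c i * g i)}"
      by blast
  qed
  note ideal = is_ideal_ideal_gen[of "g ` I", unfolded is_ideal_def]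
  have "(\<Sum>i\<in>J. c i * g i) \<in> ideal_gen (g ` I)" if "finite J" "J \<subseteq> I" for c J
    using that
  proof induction
    case empty
    show ?case
      using ideal by simp
  next
    case (insert j J)
    then have "g j \<in> ideal_gen (g ` I)" "(\<Sum>i\<in>J. c i * g i) \<in> ideal_gen (g ` I)"
      using ideal_gen_superset[of "g ` I"] by blast+
    then have "c j * g j + (\<Sum>i\<in>J. c i * g i) \<in> ideal_gen (g ` I)"
      using ideal by blast
    then show ?case
      using insert.hyps by simp
  qed
  then show "{x. \<exists>c. x = (\<Sum>i\<in>I. c i * g i)} \<subseteq> ideal_gen (g ` I)"
    using fin by blast
qed

lemma ideal_gen_insert_0: "ideal_gen (insert 0 S) = ideal_gen S"
proof -
  have "insert 0 S \<subseteq> I \<longleftrightarrow> S \<subseteq> I" if "is_ideal I" for I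
    using that by (simp add: is_ideal_def)
  then show ?thesis
    unfolding ideal_gen_def by (intro arg_cong[of _ _ Inter] Collect_cong) blast
qed

section \<open>The quotients of a discrete valuation ring\<close>

lemma quot_map_eq_0_iff:
  fixes x :: "'v::dvr"
  shows "(quot_map x :: ('v, 'k::finite) dvr_quot) = 0 \<longleftrightarrow> uniformizer ^ CARD('k) dvd x"
  by transfer (simp add: ideal_gen_singleton)

lemma comm_ring_hom_quot_map: "comm_ring_hom (quot_map :: 'v::dvr \<Rightarrow> ('v, 'k::finite) dvr_quot)"
  by unfold_locales (transfer; simp add: ideal_gen_singleton)+

lemma surj_quot_map: "surj (quot_map :: 'v::dvr \<Rightarrow> ('v, 'k::finite) dvr_quot)"
proof (rule surjI)
  show "quot_map (rep_dvr_quot x) = x" for x :: "('v, 'k) dvr_quot"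
    using Quotient3_abs_rep[OF Quotient3_dvr_quot] by (simp add: quot_map.abs_eq)
qed

text \<open>
  By maximality, $a$ and the uniformizer generate the unit ideal.
\<close>

lemma ex_inverse_mod_uniformizer:
  fixes a :: "'v::dvr"
  assumes "\<not> uniformizer dvd a"
  shows "\<exists>b. uniformizer dvd b * a - 1"
proof -
  define M where "M = ideal_gen {uniformizer :: 'v}"
  have max: "is_maximal_ideal M"
    unfolding M_def by (simp add: maximal_ideal_iff)
  define J where "J = ideal_gen {a, uniformizer}"
  have "M \<subseteq> J"
    unfolding M_def J_def using ideal_gen_superset[of "{a, uniformizer}"]
    by (intro ideal_gen_minimal is_ideal_ideal_gen) auto
  moreover have "a \<in> J"
    using ideal_gen_superset[of "{a, uniformizer}"] by (auto simp: J_def)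
  moreover have "a \<notin> M"
    using assms by (simp add: M_def ideal_gen_singleton)
  ultimately have "J = UNIV"
    using max is_ideal_ideal_gen[of "{a, uniformizer}"] unfolding is_maximal_ideal_def J_def[symmetric]
    by blast
  moreover have "J \<subseteq> {x. \<exists>b. uniformizer dvd b * a - x}"
    unfolding J_def
  proof (rule ideal_gen_minimal)
    show "is_ideal {x. \<exists>b. uniformizer dvd b * a - x}"
      unfolding is_ideal_def
    proof (intro conjI ballI allI)
      show "0 \<in> {x. \<exists>b. uniformizer dvd b * a - x}"
        by (intro CollectI exI[of _ 0]) simp
    next
      fix x y assume "x \<in> {x. \<exists>b. uniformizer dvd b * a - x}" "y \<in> {x. \<exists>b. uniformizer dvd b * a - x}"
      then obtain b c where "uniformizer dvd b * a - x" "uniformizer dvd c * a - y"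
        by blast
      then have "uniformizer dvd (b * a - x) + (c * a - y)"
        by (rule dvd_add)
      then show "x + y \<in> {x. \<exists>b. uniformizer dvd b * a - x}"
        by (intro CollectI exI[of _ "b + c"]) (simp add: algebra_simps)
    next
      fix c x assume "x \<in> {x. \<exists>b. uniformizer dvd b * a - x}"
      then obtain b where "uniformizer dvd b * a - x"
        by blast
      then have "uniformizer dvd c * (b * a - x)"
        by simp
      then show "c * x \<in> {x. \<exists>b. uniformizer dvd b * a - x}"
        by (intro CollectI exI[of _ "c * b"]) (simp add: algebra_simps)
    qed
    have "\<exists>b. uniformizer dvd b * a - a"
      by (intro exI[of _ 1]) simp
    moreover have "\<exists>b. uniformizer dvd b * a - uniformizer"
      by (intro exI[of _ 0]) simp
    ultimately show "{a, uniformizer} \<subseteq> {x. \<exists>b. uniformizer dvd b * a - x}"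
      by simp
  qed
  ultimately show ?thesis
    by blast
qed

lemma ex_left_inverse_residue_field:
  fixes x :: "('v::dvr, 'k::CARD_1) dvr_quot"
  assumes "x \<noteq> 0"
  shows "\<exists>y. y * x = 1"
proof -
  interpret quot: comm_ring_hom "quot_map :: 'v \<Rightarrow> ('v, 'k) dvr_quot"
    by (rule comm_ring_hom_quot_map)
  obtain a where a: "x = quot_map a"
    using surj_quot_map by (metis surjD)
  then have "\<not> uniformizer dvd a"
    using assms by (simp add: quot_map_eq_0_iff CARD_1)
  then obtain b where "uniformizer dvd b * a - 1"
    using ex_inverse_mod_uniformizer by blast
  then have "(quot_map (b * a - 1) :: ('v, 'k) dvr_quot) = 0"
    by (simp add: quot_map_eq_0_iff CARD_1)
  then have "quot_map b * x = 1"
    by (simp add: a quot.hom_minus quot.hom_mult)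
  then show ?thesis ..
qed

text \<open>
  The residue field is the quotient with exponent $1$, so the field structure is attached to
  exponent types with one element.  The remaining instances are the trivial Euclidean structure of a
  field, on which unique factorization of polynomials rests.
\<close>

instantiation dvr_quot :: (dvr, CARD_1) field
begin

definition inverse_dvr_quot :: "('a, 'b) dvr_quot \<Rightarrow> ('a, 'b) dvr_quot" where
  "inverse_dvr_quot x = (if x = 0 then 0 else SOME y. y * x = 1)"

definition divide_dvr_quot :: "('a, 'b) dvr_quot \<Rightarrow> ('a, 'b) dvr_quot \<Rightarrow> ('a, 'b) dvr_quot" where
  "divide_dvr_quot x y = x * inverse y"

instance
proof
  fix x :: "('a, 'b) dvr_quot"
  assume "x \<noteq> 0"
  then show "inverse x * x = 1"
    using someI_ex[OF ex_left_inverse_residue_field] by (simp add: inverse_dvr_quot_def)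
qed (simp_all add: inverse_dvr_quot_def divide_dvr_quot_def)

end

instantiation dvr_quot :: (dvr, CARD_1)
  "{unique_euclidean_ring, normalization_euclidean_semiring, normalization_semidom_multiplicative}"
begin

definition modulo_dvr_quot :: "('a, 'b) dvr_quot \<Rightarrow> ('a, 'b) dvr_quot \<Rightarrow> ('a, 'b) dvr_quot" where
  [simp]: "modulo_dvr_quot x y = (if y = 0 then x else 0)"

definition normalize_dvr_quot :: "('a, 'b) dvr_quot \<Rightarrow> ('a, 'b) dvr_quot" where
  [simp]: "normalize_dvr_quot x = (if x = 0 then 0 else 1)"

definition unit_factor_dvr_quot :: "('a, 'b) dvr_quot \<Rightarrow> ('a, 'b) dvr_quot" where
  [simp]: "unit_factor_dvr_quot x = x"

definition euclidean_size_dvr_quot :: "('a, 'b) dvr_quot \<Rightarrow> nat" where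
  [simp]: "euclidean_size_dvr_quot x = (if x = 0 then 0 else 1)"

definition division_segment_dvr_quot :: "('a, 'b) dvr_quot \<Rightarrow> ('a, 'b) dvr_quot" where
  [simp]: "division_segment_dvr_quot x = 1"

instance
  by standard (simp_all add: dvd_field_iff field_split_simps split: if_splits)

end

instantiation dvr_quot :: (dvr, CARD_1) euclidean_ring_gcd
begin

definition gcd_dvr_quot :: "('a, 'b) dvr_quot \<Rightarrow> ('a, 'b) dvr_quot \<Rightarrow> ('a, 'b) dvr_quot" where
  "gcd_dvr_quot = Euclidean_Algorithm.gcd"

definition lcm_dvr_quot :: "('a, 'b) dvr_quot \<Rightarrow> ('a, 'b) dvr_quot \<Rightarrow> ('a, 'b) dvr_quot" where
  "lcm_dvr_quot = Euclidean_Algorithm.lcm"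

definition Gcd_dvr_quot :: "('a, 'b) dvr_quot set \<Rightarrow> ('a, 'b) dvr_quot" where
  "Gcd_dvr_quot = Euclidean_Algorithm.Gcd"

definition Lcm_dvr_quot :: "('a, 'b) dvr_quot set \<Rightarrow> ('a, 'b) dvr_quot" where
  "Lcm_dvr_quot = Euclidean_Algorithm.Lcm"

instance
  by standard (simp_all add: gcd_dvr_quot_def lcm_dvr_quot_def Gcd_dvr_quot_def Lcm_dvr_quot_def)

end

instance dvr_quot :: (dvr, CARD_1) field_gcd ..

lemma finite_residue_map_quot_map:
  assumes "finite (UNIV :: ('v::dvr, 1) dvr_quot set)"
  shows "finite_residue_map (quot_map :: 'v \<Rightarrow> ('v, 1) dvr_quot) uniformizer"
proof -
  interpret quot: comm_ring_hom "quot_map :: 'v \<Rightarrow> ('v, 1) dvr_quot"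
    by (rule comm_ring_hom_quot_map)
  show ?thesis
    using assms
    by unfold_locales (simp_all add: surj_quot_map quot_map_eq_0_iff uniformizer_nonzero)
qed

text \<open>
  Every matrix over the quotient lifts, and evaluation commutes with the reduction.
\<close>

lemma map_poly_quot_map_in_null_ideal_iff:
  fixes f :: "'v::dvr poly"
  shows "(map_poly quot_map f :: ('v, 'k::finite) dvr_quot poly) \<in> null_ideal n (carrier_mat n n) \<longleftrightarrow>
    (\<forall>A\<in>carrier_mat n n. \<forall>i<n. \<forall>j<n. uniformizer ^ CARD('k) dvd mat_eval n f A $$ (i, j))"
proof -
  let ?quot = "quot_map :: 'v \<Rightarrow> ('v, 'k) dvr_quot"
  have ev: "mat_eval n (map_poly ?quot f) (map_mat ?quot A) = 0\<^sub>m n n \<longleftrightarrow>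
      (\<forall>i<n. \<forall>j<n. uniformizer ^ CARD('k) dvd mat_eval n f A $$ (i, j))"
    if "A \<in> carrier_mat n n" for A
    unfolding mat_eval_map_poly[OF comm_ring_hom_quot_map that]
    by (auto simp: mat_eq_iff quot_map_eq_0_iff)
  have "B \<in> map_mat ?quot ` carrier_mat n n" if B: "B \<in> carrier_mat n n" for B
  proof (rule image_eqI)
    show "map_mat (inv_into UNIV ?quot) B \<in> carrier_mat n n"
      using B by simp
    show "B = map_mat ?quot (map_mat (inv_into UNIV ?quot) B)"
      by (intro eq_matI) (simp_all add: surj_f_inv_f[OF surj_quot_map])
  qed
  then have carrier: "carrier_mat n n = map_mat ?quot ` carrier_mat n n"
    by auto
  have "map_poly ?quot f \<in> null_ideal n (carrier_mat n n) \<longleftrightarrow>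
      (\<forall>A\<in>carrier_mat n n. mat_eval n (map_poly ?quot f) (map_mat ?quot A) = 0\<^sub>m n n)"
    unfolding null_ideal_def by (subst carrier) simp
  then show ?thesis
    using ev by simp
qed

theorem theorem4p10:
  fixes n k q :: nat
    and \<pi> :: "('v::dvr, 'k::finite) dvr_quot"
    and \<Phi> :: "('v, 'k) dvr_quot poly"
  assumes "finite (UNIV :: ('v, 1) dvr_quot set)"
    and "q = CARD(('v, 1) dvr_quot)"
    and "n \<ge> 1"
    and "k = CARD('k)" and "1 \<le> k" and "k \<le> q"
    and "\<pi> = quot_map uniformizer"
    and "\<Phi> = Phi q n"
  shows "null_ideal n (carrier_mat n n :: ('v, 'k) dvr_quot mat set) = ideal_power (ideal_gen {\<Phi>, [:\<pi>:]}) k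
    \<and> ideal_power (ideal_gen {\<Phi>, [:\<pi>:]}) k = ideal_gen {[:\<pi> ^ i:] * \<Phi> ^ (k - i) | i. i < k}"
proof -
  interpret residue: finite_residue_map "quot_map :: 'v \<Rightarrow> ('v, 1) dvr_quot" uniformizer
    using assms(1) by (rule finite_residue_map_quot_map)
  interpret quot: comm_ring_hom "quot_map :: 'v \<Rightarrow> ('v, 'k) dvr_quot"
    by (rule comm_ring_hom_quot_map)
  interpret quot_poly: map_poly_comm_ring_hom "quot_map :: 'v \<Rightarrow> ('v, 'k) dvr_quot" ..
  let ?M = "map_poly (quot_map :: 'v \<Rightarrow> ('v, 'k) dvr_quot)"
  have Phi: "?M (Phi q n) = \<Phi>"
    by (simp add: assms(8) Phi_def hom_distribs)
  have \<pi>: "quot_map (uniformizer ^ i) = \<pi> ^ i" for i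
    by (simp add: assms(7) hom_distribs)
  have sum_map: "?M (\<Sum>m\<le>k. smult (uniformizer ^ (k - m)) (h m * Phi q n ^ m))
      = (\<Sum>m\<le>k. ?M (h m) * ([:\<pi> ^ (k - m):] * \<Phi> ^ m))" for h
    by (simp add: hom_distribs Phi assms(7))
  have gens: "{[:\<pi>:] ^ i * \<Phi> ^ (k - i) | i. i \<le> k} = (\<lambda>m. [:\<pi> ^ (k - m):] * \<Phi> ^ m) ` {..k}"
  proof -
    have "[:\<pi>:] ^ i * \<Phi> ^ (k - i) = [:\<pi> ^ (k - (k - i)):] * \<Phi> ^ (k - i)" if "i \<le> k" for i
      using that by (simp add: poly_const_pow)
    moreover have "[:\<pi> ^ (k - m):] * \<Phi> ^ m = [:\<pi>:] ^ (k - m) * \<Phi> ^ (k - (k - m))" if "m \<le> k" for m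
      using that by (simp add: poly_const_pow)
    ultimately show ?thesis
      by (intro equalityI subsetI) (fastforce intro: image_eqI)+
  qed
  have power: "ideal_power (ideal_gen {\<Phi>, [:\<pi>:]}) k
      = {x. \<exists>c. x = (\<Sum>m\<le>k. c m * ([:\<pi> ^ (k - m):] * \<Phi> ^ m))}"
    unfolding ideal_power_ideal_gen_pair gens by (rule ideal_gen_image) simp
  have surj: "\<exists>F. ?M F = f" for f
    using quot.ex_lift_poly[OF surj_quot_map] by blast
  have "f \<in> null_ideal n (carrier_mat n n) \<longleftrightarrow> f \<in> ideal_power (ideal_gen {\<Phi>, [:\<pi>:]}) k" for f
  proof -
    have iff: "?M F \<in> null_ideal n (carrier_mat n n) \<longleftrightarrow>
        (\<exists>h. F = (\<Sum>m\<le>k. smult (uniformizer ^ (k - m)) (h m * Phi q n ^ m)))" for F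
      using residue.uniformizer_power_dvd_mat_eval_iff[OF assms(2,6), of n F] assms(3,4)
      by (simp add: map_poly_quot_map_in_null_ideal_iff)
    show ?thesis
    proof
      assume f: "f \<in> null_ideal n (carrier_mat n n)"
      obtain F where F: "?M F = f"
        using surj by blast
      then obtain h where "F = (\<Sum>m\<le>k. smult (uniformizer ^ (k - m)) (h m * Phi q n ^ m))"
        using f iff[of F] by blast
      then have "f = (\<Sum>m\<le>k. ?M (h m) * ([:\<pi> ^ (k - m):] * \<Phi> ^ m))"
        using F sum_map by simp
      then show "f \<in> ideal_power (ideal_gen {\<Phi>, [:\<pi>:]}) k"
        unfolding power by (intro CollectI exI[of _ "\<lambda>m. ?M (h m)"])
    next
      assume "f \<in> ideal_power (ideal_gen {\<Phi>, [:\<pi>:]}) k"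
      then obtain c where c: "f = (\<Sum>m\<le>k. c m * ([:\<pi> ^ (k - m):] * \<Phi> ^ m))"
        unfolding power by blast
      have "\<forall>m. \<exists>F. ?M F = c m"
        using surj by blast
      from choice[OF this] obtain h where h: "\<forall>m. ?M (h m) = c m" ..
      have "f = ?M (\<Sum>m\<le>k. smult (uniformizer ^ (k - m)) (h m * Phi q n ^ m))"
        unfolding sum_map using c h by simp
      then show "f \<in> null_ideal n (carrier_mat n n)"
        using iff by blast
    qed
  qed
  moreover have "ideal_power (ideal_gen {\<Phi>, [:\<pi>:]}) k = ideal_gen {[:\<pi> ^ i:] * \<Phi> ^ (k - i) | i. i < k}"
  proof -
    have "\<pi> ^ k = 0"
      unfolding \<pi>[symmetric] quot_map_eq_0_iff assms(4) by simp
    have "{[:\<pi>:] ^ i * \<Phi> ^ (k - i) | i. i \<le> k} = insert 0 {[:\<pi> ^ i:] * \<Phi> ^ (k - i) | i. i < k}"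
    proof -
      have "{[:\<pi>:] ^ i * \<Phi> ^ (k - i) | i. i \<le> k} = (\<lambda>i. [:\<pi> ^ i:] * \<Phi> ^ (k - i)) ` {..k}"
        by (auto simp: poly_const_pow)
      also have "{..k} = insert k {..<k}"
        by auto
      also have "(\<lambda>i. [:\<pi> ^ i:] * \<Phi> ^ (k - i)) ` \<dots> = insert 0 {[:\<pi> ^ i:] * \<Phi> ^ (k - i) | i. i < k}"
        using \<open>\<pi> ^ k = 0\<close> by auto
      finally show ?thesis .
    qed
    then show ?thesis
      by (simp only: ideal_power_ideal_gen_pair ideal_gen_insert_0)
  qed
  ultimately show ?thesis
    by blast
qed

end
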